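(* Let $K$ be a valued field with value group $\Gamma$ and let $T = \mathrm{Th}(K; +, \cdot, |)$. If $T$ is quasi-VC-minimal, then $\Gamma$ is divisible.
   Context: The valuation is $v:K\to\Gamma\cup\{\infty\}$, and $x\mid y$ is the binary relation on $K$ meaning $v(x)\le v(y)$. $T$ is the complete theory of $K$ in the one-sorted language $\{+,\cdot,|\}$. $\Gamma$ (an ordered abelian group) is divisible if $n\Gamma=\Gamma$ for all $n\ge1$. Directedness: for a set $X$, a family $\mathcal{B}\subseteq\mathcal{P}(X)$ is directed if for all $A,B\in\mathcal{B}$ either $A\subseteq B$, or $B\subseteq A$, or $A\cap B=\emptyset$. For a theory $T$, a set of formulas $\Psi=\{\psi_i(x;\bar y_i) : i\in I\}$ ($x$ a single variable, the parameter variables $\bar y_i$ may vary with $i$) is directed if for all $\mathfrak{M}\models T$ the family $\{\psi_i(\mathfrak{M};\bar a) : i\in I, \bar a\in M^{|\bar y_i|}\}$ is directed, where $\psi_i(\mathfrak{M};\bar a)=\{b\in M : \mathfrak{M}\models\psi_i(b;\bar a)\}$. Quasi-VC-minimality: $T$ is quasi-VC-minimal if there is a directed $\Psi$ such that every formula $\varphi(x)$ in the single variable $x$, with parameters from a model of $T$, is $T$-equivalent to a boolean combination of instances $\psi(x;\bar a)$ of formulas $\psi\in\Psi$ and parameter-free formulas in $x$. *)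

theory Defs
  imports Main "HOL-Library.Infinite_Typeclass"
begin

section \<open>Valued fields\<close>

text \<open>\<open>'g with_infty\<close> is the disjoint union of \<open>'g\<close> with a new top element,
  which is absorbing for addition.\<close>

datatype 'g with_infty = Fin 'g | Infty

instantiation with_infty :: (linorder) linorder
begin

definition less_eq_with_infty :: "'a with_infty \<Rightarrow> 'a with_infty \<Rightarrow> bool" where
  "x \<le> y \<longleftrightarrow> (case y of Infty \<Rightarrow> True | Fin h \<Rightarrow>
                (case x of Infty \<Rightarrow> False | Fin g \<Rightarrow> g \<le> h))"

definition less_with_infty :: "'a with_infty \<Rightarrow> 'a with_infty \<Rightarrow> bool" where
  "x < y \<longleftrightarrow> x \<le> y \<and> \<not> y \<le> x" for x y :: "'a with_infty"

instance
  by standard (auto simp: less_eq_with_infty_def less_with_infty_def split: with_infty.splits)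

end

instantiation with_infty :: (plus) plus
begin

definition plus_with_infty :: "'a with_infty \<Rightarrow> 'a with_infty \<Rightarrow> 'a with_infty" where
  "x + y = (case x of Infty \<Rightarrow> Infty | Fin g \<Rightarrow>
             (case y of Infty \<Rightarrow> Infty | Fin h \<Rightarrow> Fin (g + h)))"

instance ..

end

text \<open>The last condition says that the type \<open>'g\<close> is exactly the value group
  (and not a proper extension of it).\<close>

locale valued_field =
  fixes v :: "'k::field \<Rightarrow> 'g::linordered_ab_group_add with_infty"
  assumes val_eq_Infty_iff: "v x = Infty \<longleftrightarrow> x = 0"
    and val_mult: "v (x * y) = v x + v y"
    and val_add: "min (v x) (v y) \<le> v (x + y)"
    and val_surj: "range v = UNIV"

definition divisible_group :: "'g::ab_group_add itself \<Rightarrow> bool" where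
  "divisible_group _ \<longleftrightarrow> (\<forall>n::nat. n \<ge> 1 \<longrightarrow> range (\<lambda>g::'g. \<Sum>i<n. g) = UNIV)"


section \<open>First-order logic over the language with \<open>+\<close>, \<open>\<cdot>\<close>, \<open>|\<close>\<close>

datatype tm = Var nat | Add tm tm | Mul tm tm

datatype fm = Eq tm tm | Dvd tm tm | Neg fm | Conj fm fm | Ex nat fm

primrec tm_vars :: "tm \<Rightarrow> nat set" where
  "tm_vars (Var i) = {i}"
| "tm_vars (Add s t) = tm_vars s \<union> tm_vars t"
| "tm_vars (Mul s t) = tm_vars s \<union> tm_vars t"

primrec free_vars :: "fm \<Rightarrow> nat set" where
  "free_vars (Eq s t) = tm_vars s \<union> tm_vars t"
| "free_vars (Dvd s t) = tm_vars s \<union> tm_vars t"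
| "free_vars (Neg \<phi>) = free_vars \<phi>"
| "free_vars (Conj \<phi> \<psi>) = free_vars \<phi> \<union> free_vars \<psi>"
| "free_vars (Ex i \<phi>) = free_vars \<phi> - {i}"

record 'm struct =
  univ :: "'m set"
  add_op :: "'m \<Rightarrow> 'm \<Rightarrow> 'm"
  mul_op :: "'m \<Rightarrow> 'm \<Rightarrow> 'm"
  dvd_rel :: "'m \<Rightarrow> 'm \<Rightarrow> bool"

definition is_structure :: "'m struct \<Rightarrow> bool" where
  "is_structure M \<longleftrightarrow> univ M \<noteq> {} \<and>
     (\<forall>x\<in>univ M. \<forall>y\<in>univ M. add_op M x y \<in> univ M \<and> mul_op M x y \<in> univ M)"

definition assignments :: "'m struct \<Rightarrow> (nat \<Rightarrow> 'm) set" where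
  "assignments M = {e. range e \<subseteq> univ M}"

primrec tm_val :: "'m struct \<Rightarrow> (nat \<Rightarrow> 'm) \<Rightarrow> tm \<Rightarrow> 'm" where
  "tm_val M e (Var i) = e i"
| "tm_val M e (Add s t) = add_op M (tm_val M e s) (tm_val M e t)"
| "tm_val M e (Mul s t) = mul_op M (tm_val M e s) (tm_val M e t)"

primrec sat :: "'m struct \<Rightarrow> (nat \<Rightarrow> 'm) \<Rightarrow> fm \<Rightarrow> bool" where
  "sat M e (Eq s t) \<longleftrightarrow> tm_val M e s = tm_val M e t"
| "sat M e (Dvd s t) \<longleftrightarrow> dvd_rel M (tm_val M e s) (tm_val M e t)"
| "sat M e (Neg \<phi>) \<longleftrightarrow> \<not> sat M e \<phi>"
| "sat M e (Conj \<phi> \<psi>) \<longleftrightarrow> sat M e \<phi> \<and> sat M e \<psi>"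
| "sat M e (Ex i \<phi>) \<longleftrightarrow> (\<exists>a\<in>univ M. sat M (e(i := a)) \<phi>)"

definition complete_theory :: "'m struct \<Rightarrow> fm set" where
  "complete_theory M = {\<phi>. free_vars \<phi> = {} \<and> (\<forall>e\<in>assignments M. sat M e \<phi>)}"

definition is_model :: "'m struct \<Rightarrow> fm set \<Rightarrow> bool" where
  "is_model M T \<longleftrightarrow> is_structure M \<and> (\<forall>\<phi>\<in>T. \<forall>e\<in>assignments M. sat M e \<phi>)"

definition (in valued_field) field_struct :: "'k struct" where
  "field_struct = \<lparr>univ = UNIV, add_op = (+), mul_op = (*), dvd_rel = (\<lambda>x y. v x \<le> v y)\<rparr>"


section \<open>Quasi-VC-minimality\<close>

text \<open>The distinguished single variable \<open>x\<close> is \<open>Var 0\<close>; all other free variables of a formula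
  are parameter variables.  A tuple of parameters is given by an assignment, of which only the
  (finitely many) values at the parameter variables matter; its value at \<open>0\<close> is overwritten.\<close>

definition holds_at :: "'m struct \<Rightarrow> fm \<Rightarrow> (nat \<Rightarrow> 'm) \<Rightarrow> 'm \<Rightarrow> bool" where
  "holds_at M \<psi> a b \<longleftrightarrow> sat M (a(0 := b)) \<psi>"

definition instance_set :: "'m struct \<Rightarrow> fm \<Rightarrow> (nat \<Rightarrow> 'm) \<Rightarrow> 'm set" where
  "instance_set M \<psi> a = {b \<in> univ M. holds_at M \<psi> a b}"

definition directed_family :: "'a set set \<Rightarrow> bool" where
  "directed_family \<B> \<longleftrightarrow> (\<forall>A\<in>\<B>. \<forall>B\<in>\<B>. A \<subseteq> B \<or> B \<subseteq> A \<or> A \<inter> B = {})"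

text \<open>HOL cannot quantify over models of \<open>T\<close> in all types at once, so the quantifiers below range
  over the models whose universe is a subset of a given \<^emph>\<open>infinite\<close> type \<open>'m\<close>.  As the language is
  countable, every finite set of parameters in a model lies in an elementary substructure that is
  countable, hence isomorphic to one with universe in \<open>'m\<close>.  For a complete theory, both
  directedness and the definability condition can fail in some model only if they fail in such a
  countable one, so the notions do not depend on the choice of \<open>'m\<close>.\<close>

definition directed_formulas :: "'m::infinite itself \<Rightarrow> fm set \<Rightarrow> fm set \<Rightarrow> bool" where
  "directed_formulas _ T \<Psi> \<longleftrightarrow>
     (\<forall>M::'m struct. is_model M T \<longrightarrow>
        directed_family {instance_set M \<psi> a | \<psi> a. \<psi> \<in> \<Psi> \<and> a \<in> assignments M})"

datatype 'a bool_comb = Atom 'a | BNot "'a bool_comb"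
  | BAnd "'a bool_comb" "'a bool_comb" | BOr "'a bool_comb" "'a bool_comb"

primrec bool_comb_holds :: "('a \<Rightarrow> bool) \<Rightarrow> 'a bool_comb \<Rightarrow> bool" where
  "bool_comb_holds h (Atom p) \<longleftrightarrow> h p"
| "bool_comb_holds h (BNot \<beta>) \<longleftrightarrow> \<not> bool_comb_holds h \<beta>"
| "bool_comb_holds h (BAnd \<beta> \<gamma>) \<longleftrightarrow> bool_comb_holds h \<beta> \<and> bool_comb_holds h \<gamma>"
| "bool_comb_holds h (BOr \<beta> \<gamma>) \<longleftrightarrow> bool_comb_holds h \<beta> \<or> bool_comb_holds h \<gamma>"

text \<open>Atoms are pairs of a formula and parameters; the parameters are irrelevant in the case
  of a formula in \<open>x\<close> alone.  Equivalence modulo \<open>T\<close> of formulas with parameters from a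
  model \<open>M\<close> means equivalence modulo the elementary diagram of \<open>M\<close>, that is, agreement at every
  point of \<open>M\<close>.\<close>

definition quasi_VC_minimal :: "'m::infinite itself \<Rightarrow> fm set \<Rightarrow> bool" where
  "quasi_VC_minimal _ T \<longleftrightarrow>
     (\<exists>\<Psi>. directed_formulas TYPE('m) T \<Psi> \<and>
       (\<forall>M::'m struct. is_model M T \<longrightarrow>
         (\<forall>\<phi>. \<forall>a\<in>assignments M. \<exists>\<beta>.
            set_bool_comb \<beta> \<subseteq> {(\<psi>, c). c \<in> assignments M \<and> (\<psi> \<in> \<Psi> \<or> free_vars \<psi> \<subseteq> {0})} \<and>
            (\<forall>b\<in>univ M. holds_at M \<phi> a b \<longleftrightarrow>
                bool_comb_holds (\<lambda>(\<psi>, c). holds_at M \<psi> c b) \<beta>))))"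

end

theory Submission
  imports Defs "HOL-Library.Countable_Set" "HOL-Library.Infinite_Set" "HOL-Library.Sublist"
begin

text \<open>Suppose that \<open>n\<Gamma> \<noteq> \<Gamma>\<close> and consider the sets \<open>Y\<^sub>a = {x. v (x - a) \<in> n\<Gamma> \<union> {\<infinity>}}\<close>. Compactness bounds the
  complexity of their definitions: each \<open>Y\<^sub>a\<close> is a combination of boundedly many
  instances of the directed family and of finitely many parameter-free formulas. Choose a finite set
  \<open>X\<close> on which these parameter-free formulas are constant. Any directed family on \<open>X\<close> consists of
  convex sets for some linear order on \<open>X\<close>, so for \<open>a \<in> X\<close> membership in \<open>Y\<^sub>a\<close> alternates a bounded number of
  times along this order. By a pigeonhole argument \<open>X\<close> can be chosen as the set of leaves of a ternary tree
  of arbitrary height \<open>h\<close> in which the valuations of differences lie alternately inside and outside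
  \<open>n\<Gamma>\<close> from level to level, and then for every linear order some \<open>a \<in> X\<close> has at least
  \<open>h\<close> alternations.\<close>

section \<open>Renaming and combining formulas\<close>

lemma tm_val_cong: "(\<And>i. i \<in> tm_vars t \<Longrightarrow> e i = e' i) \<Longrightarrow> tm_val M e t = tm_val M e' t"
  by (induction t) simp_all

lemma sat_cong: "(\<And>i. i \<in> free_vars \<phi> \<Longrightarrow> e i = e' i) \<Longrightarrow> sat M e \<phi> \<longleftrightarrow> sat M e' \<phi>"
proof (induction \<phi> arbitrary: e e')
  case (Eq s t)
  then show ?case using tm_val_cong[of s e e' M] tm_val_cong[of t e e' M] by simp
next
  case (Dvd s t)
  then show ?case using tm_val_cong[of s e e' M] tm_val_cong[of t e e' M] by simp
next
  case (Neg \<phi>)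
  have "sat M e \<phi> \<longleftrightarrow> sat M e' \<phi>" by (rule Neg.IH, rule Neg.prems) simp
  then show ?case by (simp only: sat.simps)
next
  case (Conj \<phi> \<psi>)
  have "sat M e \<phi> \<longleftrightarrow> sat M e' \<phi>" by (rule Conj.IH(1), rule Conj.prems) simp
  moreover have "sat M e \<psi> \<longleftrightarrow> sat M e' \<psi>" by (rule Conj.IH(2), rule Conj.prems) simp
  ultimately show ?case by (simp only: sat.simps)
next
  case (Ex i \<phi>)
  have "sat M (e(i := a)) \<phi> \<longleftrightarrow> sat M (e'(i := a)) \<phi>" for a
    by (rule Ex.IH) (use Ex.prems in auto)
  then show ?case by (simp only: sat.simps)
qed

lemma finite_free_vars: "finite (free_vars \<phi>)"
proof -
  have "finite (tm_vars t)" for t by (induction t) simp_all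
  then show ?thesis by (induction \<phi>) simp_all
qed

lemma assignments_upd: "e \<in> assignments M \<Longrightarrow> a \<in> univ M \<Longrightarrow> e(i := a) \<in> assignments M"
  by (auto simp: assignments_def)

lemma assignmentsD: "e \<in> assignments M \<Longrightarrow> e i \<in> univ M"
  by (auto simp: assignments_def)

lemma tm_val_closed: "is_structure M \<Longrightarrow> e \<in> assignments M \<Longrightarrow> tm_val M e t \<in> univ M"
  by (induction t) (auto simp: is_structure_def assignments_def)

primrec rename_tm :: "(nat \<Rightarrow> nat) \<Rightarrow> tm \<Rightarrow> tm" where
  "rename_tm f (Var i) = Var (f i)"
| "rename_tm f (Add s t) = Add (rename_tm f s) (rename_tm f t)"
| "rename_tm f (Mul s t) = Mul (rename_tm f s) (rename_tm f t)"

text \<open>Bound variables are renamed as well, so an injective \<open>f\<close> captures no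
  variable and commutes with updating an assignment.\<close>

primrec rename :: "(nat \<Rightarrow> nat) \<Rightarrow> fm \<Rightarrow> fm" where
  "rename f (Eq s t) = Eq (rename_tm f s) (rename_tm f t)"
| "rename f (Dvd s t) = Dvd (rename_tm f s) (rename_tm f t)"
| "rename f (Neg \<phi>) = Neg (rename f \<phi>)"
| "rename f (Conj \<phi> \<psi>) = Conj (rename f \<phi>) (rename f \<psi>)"
| "rename f (Ex i \<phi>) = Ex (f i) (rename f \<phi>)"

lemma sat_rename:
  assumes "inj f"
  shows "sat M e (rename f \<phi>) \<longleftrightarrow> sat M (e \<circ> f) \<phi>"
proof -
  have "tm_val M e (rename_tm f t) = tm_val M (e \<circ> f) t" for t e by (induction t) simp_all
  moreover have "(e(f i := a)) \<circ> f = (e \<circ> f)(i := a)" for e :: "nat \<Rightarrow> 'a" and i a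
    using injD[OF assms] by fastforce
  ultimately show ?thesis by (induction \<phi> arbitrary: e) simp_all
qed

section \<open>Storing many parameter tuples in one assignment\<close>

text \<open>Countably many assignments \<open>c k\<close> are stored in disjoint sets of variables of one assignment;
  the variable \<open>0\<close> is common to all of them.\<close>

definition slot :: "nat \<Rightarrow> nat \<Rightarrow> nat" where
  "slot k i = (case i of 0 \<Rightarrow> 0 | Suc j \<Rightarrow> Suc (prod_encode (k, j)))"

definition join :: "(nat \<Rightarrow> nat \<Rightarrow> 'm) \<Rightarrow> nat \<Rightarrow> 'm" where
  "join c m = (case m of 0 \<Rightarrow> c 0 0 | Suc p \<Rightarrow> (case prod_decode p of (k, j) \<Rightarrow> c k (Suc j)))"

lemma inj_slot: "inj (slot k)"
  by (auto simp: inj_def slot_def split: nat.splits)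

lemma upd_slot: "(e(0 := b)) \<circ> slot k = (e \<circ> slot k)(0 := b)"
  by (auto simp: fun_eq_iff slot_def split: nat.splits)

lemma join_slot: "(join c \<circ> slot k)(0 := b) = (c k)(0 := b)"
  by (auto simp: fun_eq_iff slot_def join_def split: nat.splits)

lemma sat_rename_slot: "sat M (e(0 := b)) (rename (slot k) \<phi>) \<longleftrightarrow> sat M ((e \<circ> slot k)(0 := b)) \<phi>"
  by (simp only: sat_rename[OF inj_slot] upd_slot)

lemma sat_join: "sat M ((join c)(0 := b)) (rename (slot k) \<phi>) \<longleftrightarrow> sat M ((c k)(0 := b)) \<phi>"
  by (simp only: sat_rename_slot join_slot)

lemma join_map: "f \<circ> join c = join (\<lambda>k. f \<circ> c k)"
  by (auto simp: fun_eq_iff join_def split: nat.splits prod.splits)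

lemma join_assignments: "(\<And>k. c k \<in> assignments M) \<Longrightarrow> join c \<in> assignments M"
  by (auto simp: assignments_def join_def image_subset_iff split: nat.splits prod.splits)

text \<open>An atom \<open>(\<psi>, k)\<close> stands for \<open>\<psi>\<close> with its parameters
  taken from slot \<open>k\<close>. Such a shape mentions no elements of a structure, so there are
  only countably many shapes and they can be compared between structures.\<close>

primrec comb_fm :: "(fm \<times> nat) bool_comb \<Rightarrow> fm" where
  "comb_fm (Atom p) = rename (slot (snd p)) (fst p)"
| "comb_fm (BNot \<beta>) = Neg (comb_fm \<beta>)"
| "comb_fm (BAnd \<beta> \<gamma>) = Conj (comb_fm \<beta>) (comb_fm \<gamma>)"
| "comb_fm (BOr \<beta> \<gamma>) = Neg (Conj (Neg (comb_fm \<beta>)) (Neg (comb_fm \<gamma>)))"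

lemma sat_comb_fm:
  "sat M (e(0 := b)) (comb_fm \<sigma>) \<longleftrightarrow>
     bool_comb_holds (\<lambda>(\<psi>, k). sat M ((e \<circ> slot k)(0 := b)) \<psi>) \<sigma>"
  by (induction \<sigma>) (simp_all add: sat_rename_slot comp_def split_beta del: fun_upd_apply)

lemma bool_comb_holds_map: "bool_comb_holds h (map_bool_comb f \<beta>) \<longleftrightarrow> bool_comb_holds (h \<circ> f) \<beta>"
  by (induction \<beta>) auto

lemma bool_comb_holds_cong:
  "(\<And>p. p \<in> set_bool_comb \<beta> \<Longrightarrow> h p = h' p) \<Longrightarrow> bool_comb_holds h \<beta> \<longleftrightarrow> bool_comb_holds h' \<beta>"
  by (induction \<beta>) auto

lemma finite_set_bool_comb: "finite (set_bool_comb \<beta>)"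
  by (induction \<beta>) auto

text \<open>Numbering the finitely many atoms gives each its own slot, so all their parameters fit
  into one assignment; only the shape and this assignment remain.\<close>

lemma bool_comb_shape:
  fixes \<beta> :: "(fm \<times> (nat \<Rightarrow> 'm)) bool_comb"
  assumes "snd ` set_bool_comb \<beta> \<subseteq> assignments M" "assignments M \<noteq> {}"
  shows "\<exists>\<sigma>. \<exists>e\<in>assignments M. fst ` set_bool_comb \<sigma> = fst ` set_bool_comb \<beta> \<and>
    (\<forall>b. sat M (e(0 := b)) (comb_fm \<sigma>) \<longleftrightarrow> bool_comb_holds (\<lambda>(\<psi>, c). holds_at M \<psi> c b) \<beta>)"
proof -
  define nm where "nm = to_nat_on (set_bool_comb \<beta>)"
  have nm: "inj_on nm (set_bool_comb \<beta>)"
    unfolding nm_def by (intro inj_on_to_nat_on countable_finite finite_set_bool_comb)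
  \<comment> \<open>The assignment \<open>d\<close> fills the slots that belong to no atom.\<close>
  obtain d where d: "d \<in> assignments M" using assms by blast
  define c where "c k = (if k \<in> nm ` set_bool_comb \<beta> then snd (inv_into (set_bool_comb \<beta>) nm k) else d)" for k
  have c: "c (nm p) = snd p" if "p \<in> set_bool_comb \<beta>" for p
    using that nm by (simp add: c_def)
  have "c k \<in> assignments M" for k
    using assms d by (auto simp: c_def nm)
  then have "join c \<in> assignments M" by (rule join_assignments)
  moreover define \<sigma> where "\<sigma> = map_bool_comb (\<lambda>p. (fst p, nm p)) \<beta>"
  have "fst ` set_bool_comb \<sigma> = fst ` set_bool_comb \<beta>"
    by (auto simp: \<sigma>_def bool_comb.set_map image_image)
  moreover have "sat M ((join c)(0 := b)) (comb_fm \<sigma>) \<longleftrightarrow>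
      bool_comb_holds (\<lambda>(\<psi>, c). holds_at M \<psi> c b) \<beta>" for b
    unfolding sat_comb_fm \<sigma>_def bool_comb_holds_map
    by (rule bool_comb_holds_cong) (auto simp: join_slot c holds_at_def)
  ultimately show ?thesis by blast
qed

text \<open>The universally quantified biconditional in primitive connectives. All slots share
  variable \<open>0\<close>, so one quantifier binds it on both sides. As a single formula it passes
  through elementary embeddings and ultrapowers.\<close>

definition equiv_fm :: "fm \<Rightarrow> fm \<Rightarrow> fm" where
  "equiv_fm \<phi> \<psi> = (let p = rename (slot 0) \<phi>; q = rename (slot 1) \<psi> in
     Neg (Ex 0 (Neg (Conj (Neg (Conj p (Neg q))) (Neg (Conj q (Neg p)))))))"

definition join2 :: "(nat \<Rightarrow> 'm) \<Rightarrow> (nat \<Rightarrow> 'm) \<Rightarrow> nat \<Rightarrow> 'm" where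
  "join2 a e = join (\<lambda>k. if k = 0 then a else e)"

lemma sat_equiv_fm:
  "sat M (join2 a e) (equiv_fm \<phi> \<psi>) \<longleftrightarrow>
    (\<forall>b\<in>univ M. sat M (a(0 := b)) \<phi> \<longleftrightarrow> sat M (e(0 := b)) \<psi>)"
  unfolding join2_def equiv_fm_def Let_def by (auto simp: sat_join)

lemma join2_map: "f \<circ> join2 a e = join2 (f \<circ> a) (f \<circ> e)"
  unfolding join2_def join_map by (rule arg_cong[where f = join]) auto

lemma join2_assignments: "a \<in> assignments M \<Longrightarrow> e \<in> assignments M \<Longrightarrow> join2 a e \<in> assignments M"
  unfolding join2_def by (rule join_assignments) auto

section \<open>The downward Loewenheim-Skolem theorem\<close>

instance tm :: countable by countable_datatype
instance fm :: countable by countable_datatype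
instance bool_comb :: (countable) countable by countable_datatype

text \<open>Closed terms for the Skolem hull of countably many constants.
  \<open>Witness \<phi> i ts\<close> names a witness for the quantifier over variable
  \<open>i\<close>; the finite list \<open>ts\<close> suffices because \<open>\<phi>\<close> has
  finitely many free variables.\<close>

datatype skolem = Const nat | Plus skolem skolem | Times skolem skolem
  | Witness fm nat "skolem list"

instance skolem :: countable by countable_datatype

definition list_assignment :: "'m \<Rightarrow> 'm list \<Rightarrow> nat \<Rightarrow> 'm" where
  "list_assignment d xs i = (if i < length xs then xs ! i else d)"

text \<open>The element \<open>c 0\<close> pads the parameter lists and is the fallback where no
  witness exists, so that values never leave the universe.\<close>

primrec skolem_val :: "'m struct \<Rightarrow> (nat \<Rightarrow> 'm) \<Rightarrow> skolem \<Rightarrow> 'm" where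
  "skolem_val M c (Const i) = c i"
| "skolem_val M c (Plus s t) = add_op M (skolem_val M c s) (skolem_val M c t)"
| "skolem_val M c (Times s t) = mul_op M (skolem_val M c s) (skolem_val M c t)"
| "skolem_val M c (Witness \<phi> i ts) =
    (let e = list_assignment (c 0) (map (skolem_val M c) ts) in
     if \<exists>a\<in>univ M. sat M (e(i := a)) \<phi> then SOME a. a \<in> univ M \<and> sat M (e(i := a)) \<phi> else c 0)"

lemma skolem_val_closed:
  assumes "is_structure M" "range c \<subseteq> univ M"
  shows "skolem_val M c s \<in> univ M"
proof (induction s)
  case (Witness \<phi> i ts)
  show ?case
    using assms(2) by (auto simp: Let_def intro: someI2_bex)
qed (use assms in \<open>auto simp: is_structure_def\<close>)

definition elementary_embedding :: "'m struct \<Rightarrow> 'n struct \<Rightarrow> ('m \<Rightarrow> 'n) \<Rightarrow> bool" where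
  "elementary_embedding N M h \<longleftrightarrow> h ` univ N \<subseteq> univ M \<and>
    (\<forall>\<phi>. \<forall>e\<in>assignments N. sat N e \<phi> \<longleftrightarrow> sat M (h \<circ> e) \<phi>)"

lemma elementary_embedding_assignments:
  "elementary_embedding N M h \<Longrightarrow> e \<in> assignments N \<Longrightarrow> h \<circ> e \<in> assignments M"
  by (auto simp: elementary_embedding_def assignments_def)

text \<open>The Skolem hull of \<open>C\<close> is countable and contains witnesses for all
  existential formulas over it. It is then transported along an injection into the infinite type of
  \<open>N\<close>.\<close>

theorem downward_loewenheim_skolem:
  fixes M :: "'n struct"
  assumes M: "is_structure M" and C: "countable C" "C \<subseteq> univ M"
  obtains N :: "'m::infinite struct" and h
  where "is_structure N" "elementary_embedding N M h" "C \<subseteq> h ` univ N"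
proof -
  obtain d where d: "d \<in> univ M" using M by (auto simp: is_structure_def)
  \<comment> \<open>Adding \<open>d\<close> makes the set nonempty, so that a sequence can enumerate
    it even if \<open>C\<close> is empty.\<close>
  obtain c :: "nat \<Rightarrow> 'n" where c: "range c = insert d C"
    using uncountable_def C(1) countable_insert by (metis insert_not_empty)
  then have cM: "range c \<subseteq> univ M" using d C by simp
  define U where "U = range (skolem_val M c)"
  have UM: "U \<subseteq> univ M" using skolem_val_closed[OF M cM] by (auto simp: U_def)
  have CU: "C \<subseteq> U"
  proof
    fix x assume "x \<in> C"
    then obtain i where "x = c i" using c by (metis insertCI rangeE)
    then have "x = skolem_val M c (Const i)" by simp
    then show "x \<in> U" unfolding U_def by blast
  qed
  \<comment> \<open>The Tarski-Vaught condition for \<open>U\<close>.\<close>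
  have witness: "\<exists>a\<in>U. sat M (e(i := a)) \<phi>"
    if "range e \<subseteq> U" "\<exists>a\<in>univ M. sat M (e(i := a)) \<phi>" for e i \<phi>
  proof -
    obtain n where n: "\<And>j. j \<in> free_vars \<phi> \<Longrightarrow> j < n"
      using finite_free_vars[of \<phi>] by (meson finite_nat_set_iff_bounded)
    have "\<forall>j. \<exists>t. e j = skolem_val M c t" using that(1) by (auto simp: U_def)
    then obtain t where t: "\<And>j. e j = skolem_val M c (t j)" by metis
    define ts where "ts = map t [0..<n]"
    let ?e = "list_assignment (c 0) (map (skolem_val M c) ts)"
    have eq: "sat M (?e(i := a)) \<phi> \<longleftrightarrow> sat M (e(i := a)) \<phi>" for a
      by (rule sat_cong) (use n t in \<open>auto simp: list_assignment_def ts_def\<close>)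
    then have "\<exists>a. a \<in> univ M \<and> sat M (?e(i := a)) \<phi>" using that(2) by blast
    then have "sat M (?e(i := skolem_val M c (Witness \<phi> i ts))) \<phi>"
      by (simp add: Let_def) (metis (mono_tags, lifting) someI_ex)
    then show ?thesis using eq unfolding U_def by blast
  qed
  have closed: "add_op M x y \<in> U" "mul_op M x y \<in> U" if xy: "x \<in> U" "y \<in> U" for x y
  proof -
    obtain s t where "x = skolem_val M c s" "y = skolem_val M c t" using xy by (auto simp: U_def)
    then have "add_op M x y = skolem_val M c (Plus s t)" "mul_op M x y = skolem_val M c (Times s t)"
      by auto
    then show "add_op M x y \<in> U" "mul_op M x y \<in> U" unfolding U_def by blast+
  qed
  obtain g1 :: "nat \<Rightarrow> 'm" where g1: "inj g1"
    using infinite_countable_subset[OF infinite_UNIV] by blast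
  have "countable U" by (simp add: U_def)
  then obtain g2 :: "'n \<Rightarrow> nat" where g2: "inj_on g2 U" by (auto simp: countable_def)
  define g where "g = g1 \<circ> g2"
  have g: "inj_on g U" unfolding g_def
    using g1 g2 by (auto intro!: comp_inj_on inj_on_subset[OF g1])
  define h where "h = inv_into U g"
  have hg: "h (g x) = x" if "x \<in> U" for x using that g by (simp add: h_def)
  define N where "N = \<lparr>univ = g ` U, add_op = \<lambda>x y. g (add_op M (h x) (h y)),
    mul_op = \<lambda>x y. g (mul_op M (h x) (h y)), dvd_rel = \<lambda>x y. dvd_rel M (h x) (h y)\<rparr>"
  have N: "is_structure N"
    using closed hg by (auto simp: is_structure_def N_def U_def)
  have hU: "h ` univ N = U" using hg by (force simp: N_def)
  \<comment> \<open>The second conjunct makes \<open>h\<close> injective on values of terms, which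
    the case of equations needs.\<close>
  have tm: "h (tm_val N e t) = tm_val M (h \<circ> e) t \<and> tm_val N e t = g (h (tm_val N e t))"
    if "e \<in> assignments N" for e t
  proof (induction t)
    case (Var i)
    have "e i \<in> g ` U" using that by (auto simp: assignments_def N_def)
    then show ?case by (auto simp: hg)
  next
    case (Add s t)
    have "h (tm_val N e s) \<in> U" "h (tm_val N e t) \<in> U" using tm_val_closed[OF N that] hU by blast+
    then show ?case using Add closed by (simp add: N_def hg)
  next
    case (Mul s t)
    have "h (tm_val N e s) \<in> U" "h (tm_val N e t) \<in> U" using tm_val_closed[OF N that] hU by blast+
    then show ?case using Mul closed by (simp add: N_def hg)
  qed
  have "sat N e \<phi> \<longleftrightarrow> sat M (h \<circ> e) \<phi>" if "e \<in> assignments N" for e \<phi>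
    using that
  proof (induction \<phi> arbitrary: e)
    case (Eq s t)
    then show ?case using tm[OF Eq] by (metis sat.simps(1))
  next
    case (Dvd s t)
    have "sat N e (Dvd s t) \<longleftrightarrow> dvd_rel M (h (tm_val N e s)) (h (tm_val N e t))"
      by (simp add: N_def)
    then show ?case by (simp only: tm[OF Dvd, THEN conjunct1] sat.simps)
  next
    case (Ex i \<phi>)
    have e: "range (h \<circ> e) \<subseteq> U" using Ex.prems hU by (auto simp: assignments_def)
    have upd: "h \<circ> e(i := a) = (h \<circ> e)(i := h a)" for a by auto
    have "sat N (e(i := a)) \<phi> \<longleftrightarrow> sat M ((h \<circ> e)(i := h a)) \<phi>" if "a \<in> univ N" for a
      using Ex.IH[OF assignments_upd[OF Ex.prems that]] by (simp only: upd)
    then have "sat N e (Ex i \<phi>) \<longleftrightarrow> (\<exists>a\<in>univ N. sat M ((h \<circ> e)(i := h a)) \<phi>)"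
      by (simp del: fun_upd_apply)
    also have "\<dots> \<longleftrightarrow> (\<exists>a\<in>U. sat M ((h \<circ> e)(i := a)) \<phi>)"
      unfolding hU[symmetric] by blast
    also have "\<dots> \<longleftrightarrow> sat M (h \<circ> e) (Ex i \<phi>)"
      using witness[OF e, of i \<phi>] UM by auto
    finally show ?case .
  qed simp_all
  then have "elementary_embedding N M h" using hU UM by (simp add: elementary_embedding_def)
  then show ?thesis using that[OF N] CU hU by blast
qed

lemma elementary_embedding_model:
  assumes "elementary_embedding N M h" "is_structure N"
  shows "is_model N (complete_theory M)"
  using assms elementary_embedding_assignments[OF assms(1)]
  by (auto simp: is_model_def complete_theory_def elementary_embedding_def)

section \<open>Ultrapowers\<close>

text \<open>The ultrafilter is generated by a maximal family of sets all of whose finite intersections are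
  infinite.\<close>

lemma nonprincipal_ultrafilter:
  "\<exists>U :: nat filter. U \<noteq> bot \<and> U \<le> sequentially \<and>
    (\<forall>P. eventually P U \<or> eventually (\<lambda>n. \<not> P n) U)"
proof -
  let ?F = "{\<F> :: nat set set. \<forall>S. finite S \<longrightarrow> S \<subseteq> \<F> \<longrightarrow> infinite (\<Inter>S)}"
  have "\<exists>M\<in>?F. \<forall>X\<in>?F. M \<subseteq> X \<longrightarrow> X = M"
  proof (rule subset_Zorn_nonempty)
    have "{} \<in> ?F" by auto
    then show "?F \<noteq> {}" by blast
    fix \<C> assume \<C>: "\<C> \<noteq> {}" "subset.chain ?F \<C>"
    have "infinite (\<Inter>S)" if S: "finite S" "S \<subseteq> \<Union>\<C>" for S
    proof -
      obtain B where "B \<in> \<C>" "S \<subseteq> B"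
        using finite_subset_Union_chain[OF S \<C>] by blast
      then show ?thesis using \<C>(2) S by (auto simp: subset.chain_def)
    qed
    then show "\<Union>\<C> \<in> ?F" by blast
  qed
  then obtain M where M: "\<And>S. finite S \<Longrightarrow> S \<subseteq> M \<Longrightarrow> infinite (\<Inter>S)"
    and max: "\<And>X. X \<in> ?F \<Longrightarrow> M \<subseteq> X \<Longrightarrow> X = M" by auto
  \<comment> \<open>By maximality, a set outside \<open>M\<close> cannot be added: it meets some
    finite intersection of members in a finite set.\<close>
  have small: "\<exists>S. finite S \<and> S \<subseteq> M \<and> finite (\<Inter>S \<inter> A)" if A: "A \<notin> M" for A
  proof -
    have "insert A M \<notin> ?F" using max[of "insert A M"] A by blast
    then obtain S where S: "finite S" "S \<subseteq> insert A M" "finite (\<Inter>S)" by auto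
    have "finite (\<Inter>(S - {A}) \<inter> A)" using S(3) by (rule finite_subset[rotated]) auto
    with S show ?thesis by (intro exI[of _ "S - {A}"]) auto
  qed
  have ultra: "A \<in> M \<or> - A \<in> M" for A
  proof (rule ccontr)
    assume "\<not> (A \<in> M \<or> - A \<in> M)"
    then obtain S S' where S: "finite S" "S \<subseteq> M" "finite (\<Inter>S \<inter> A)"
      "finite S'" "S' \<subseteq> M" "finite (\<Inter>S' \<inter> - A)" using small by meson
    \<comment> \<open>If neither \<open>A\<close> nor its complement were a member, a finite
      intersection of members would be covered by two finite sets.\<close>
    have "\<Inter>(S \<union> S') \<subseteq> (\<Inter>S \<inter> A) \<union> (\<Inter>S' \<inter> - A)" by auto
    then have "finite (\<Inter>(S \<union> S'))" using S by (meson finite_Un finite_subset)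
    with M[of "S \<union> S'"] S show False by auto
  qed
  define U where "U = (INF A\<in>M. principal A)"
  have ev: "eventually P U" if "{n. P n} \<in> M" for P
    unfolding U_def by (rule eventually_INF1[OF that]) (simp add: eventually_principal)
  have "U \<noteq> bot"
    unfolding U_def
  proof (rule INF_filter_not_bot)
    fix S assume S: "S \<subseteq> M" "finite S"
    then have "infinite (\<Inter>S)" by (intro M)
    then have "\<Inter>S \<noteq> {}" by auto
    with S show "(INF A\<in>S. principal A) \<noteq> bot"
      by (simp add: INF_principal_finite principal_eq_bot_iff)
  qed
  moreover have "U \<le> sequentially"
  proof -
    \<comment> \<open>The complement of \<open>{k..}\<close> is finite, so it is no member.
      Demanding infinite intersections thus makes the ultrafilter nonprincipal.\<close>
    have "{k..} \<in> M" for k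
      using ultra[of "{k..}"] M[of "{- {k..}}"] by auto
    then show ?thesis
      unfolding le_sequentially using ev[of "\<lambda>n. n \<ge> _"] by (simp add: atLeast_def)
  qed
  moreover have "eventually P U \<or> eventually (\<lambda>n. \<not> P n) U" for P
    using ultra[of "{n. P n}"] ev[of P] ev[of "\<lambda>n. \<not> P n"] by (auto simp: Collect_neg_eq)
  ultimately show ?thesis by blast
qed

context
  fixes M :: "'m struct" and U :: "nat filter"
begin

text \<open>The ultrapower is the set of canonical representatives of the classes of sequences.\<close>

definition ultra_repr :: "(nat \<Rightarrow> 'm) \<Rightarrow> nat \<Rightarrow> 'm" where
  "ultra_repr f = (SOME g. range g \<subseteq> univ M \<and> eventually (\<lambda>n. g n = f n) U)"

definition ultrapower :: "(nat \<Rightarrow> 'm) struct" where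
  "ultrapower = \<lparr>univ = ultra_repr ` {f. range f \<subseteq> univ M},
     add_op = \<lambda>f g. ultra_repr (\<lambda>n. add_op M (f n) (g n)),
     mul_op = \<lambda>f g. ultra_repr (\<lambda>n. mul_op M (f n) (g n)),
     dvd_rel = \<lambda>f g. eventually (\<lambda>n. dvd_rel M (f n) (g n)) U\<rparr>"

lemma ultra_repr:
  assumes "range f \<subseteq> univ M"
  shows "range (ultra_repr f) \<subseteq> univ M" "eventually (\<lambda>n. ultra_repr f n = f n) U"
proof -
  have "range (ultra_repr f) \<subseteq> univ M \<and> eventually (\<lambda>n. ultra_repr f n = f n) U"
    unfolding ultra_repr_def by (rule someI[of _ f]) (simp add: assms)
  then show "range (ultra_repr f) \<subseteq> univ M" "eventually (\<lambda>n. ultra_repr f n = f n) U" by auto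
qed

lemma ultra_repr_eq_iff:
  assumes "range f \<subseteq> univ M" "range g \<subseteq> univ M"
  shows "ultra_repr f = ultra_repr g \<longleftrightarrow> eventually (\<lambda>n. f n = g n) U"
proof
  assume "ultra_repr f = ultra_repr g"
  then show "eventually (\<lambda>n. f n = g n) U"
    using eventually_conj[OF ultra_repr(2)[OF assms(1)] ultra_repr(2)[OF assms(2)]]
    by (auto elim: eventually_mono)
next
  assume *: "eventually (\<lambda>n. f n = g n) U"
  \<comment> \<open>Equivalent sequences give the choice operator the same predicate, hence
    literally the same representative.\<close>
  have "eventually (\<lambda>n. h n = f n) U \<longleftrightarrow> eventually (\<lambda>n. h n = g n) U" for h
    using eventually_subst[OF eventually_mono[OF *, of "\<lambda>n. (h n = f n) = (h n = g n)"]] by simp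
  then show "ultra_repr f = ultra_repr g" by (simp add: ultra_repr_def)
qed

lemma univ_ultrapowerD: "x \<in> univ ultrapower \<Longrightarrow> \<exists>f. range f \<subseteq> univ M \<and> x = ultra_repr f"
  by (auto simp: ultrapower_def)

lemma ultrapower_structure:
  assumes "is_structure M"
  shows "is_structure ultrapower"
proof -
  obtain d where "d \<in> univ M" using assms by (auto simp: is_structure_def)
  then have "range (\<lambda>_::nat. d) \<subseteq> univ M" by auto
  then have "univ ultrapower \<noteq> {}" by (auto simp: ultrapower_def)
  then show ?thesis
    using assms ultra_repr(1) unfolding is_structure_def ultrapower_def
    by (auto intro!: imageI simp: image_subset_iff)
qed

lemma tm_val_ultrapower:
  assumes M: "is_structure M" and s: "\<And>n. (\<lambda>i. s i n) \<in> assignments M"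
  shows "tm_val ultrapower (\<lambda>i. ultra_repr (s i)) t = ultra_repr (\<lambda>n. tm_val M (\<lambda>i. s i n) t)"
proof (induction t)
  case (Add t t')
  let ?f = "\<lambda>n. tm_val M (\<lambda>i. s i n) t" and ?g = "\<lambda>n. tm_val M (\<lambda>i. s i n) t'"
  have r: "range ?f \<subseteq> univ M" "range ?g \<subseteq> univ M" using tm_val_closed[OF M s] by blast+
  have "eventually (\<lambda>n. add_op M (ultra_repr ?f n) (ultra_repr ?g n) = add_op M (?f n) (?g n)) U"
    using eventually_conj[OF ultra_repr(2)[OF r(1)] ultra_repr(2)[OF r(2)]]
    by (auto elim: eventually_mono)
  moreover have "range (\<lambda>n. add_op M (ultra_repr ?f n) (ultra_repr ?g n)) \<subseteq> univ M"
    "range (\<lambda>n. add_op M (?f n) (?g n)) \<subseteq> univ M"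
    using M r ultra_repr(1) unfolding is_structure_def by blast+
  ultimately have "add_op ultrapower (ultra_repr ?f) (ultra_repr ?g) = ultra_repr (\<lambda>n. add_op M (?f n) (?g n))"
    by (simp add: ultra_repr_eq_iff ultrapower_def)
  then show ?case by (simp add: Add)
next
  case (Mul t t')
  let ?f = "\<lambda>n. tm_val M (\<lambda>i. s i n) t" and ?g = "\<lambda>n. tm_val M (\<lambda>i. s i n) t'"
  have r: "range ?f \<subseteq> univ M" "range ?g \<subseteq> univ M" using tm_val_closed[OF M s] by blast+
  have "eventually (\<lambda>n. mul_op M (ultra_repr ?f n) (ultra_repr ?g n) = mul_op M (?f n) (?g n)) U"
    using eventually_conj[OF ultra_repr(2)[OF r(1)] ultra_repr(2)[OF r(2)]]
    by (auto elim: eventually_mono)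
  moreover have "range (\<lambda>n. mul_op M (ultra_repr ?f n) (ultra_repr ?g n)) \<subseteq> univ M"
    "range (\<lambda>n. mul_op M (?f n) (?g n)) \<subseteq> univ M"
    using M r ultra_repr(1) unfolding is_structure_def by blast+
  ultimately have "mul_op ultrapower (ultra_repr ?f) (ultra_repr ?g) = ultra_repr (\<lambda>n. mul_op M (?f n) (?g n))"
    by (simp add: ultra_repr_eq_iff ultrapower_def)
  then show ?case by (simp add: Mul)
qed simp

text \<open>Los's theorem; \<open>s i n\<close> is coordinate \<open>n\<close> of the value of
  variable \<open>i\<close>. Negation rests on the ultrafilter property, the quantifier on choosing
  witnesses coordinatewise.\<close>

theorem los:
  assumes M: "is_structure M"
    and U: "U \<noteq> bot" "\<And>P. eventually P U \<or> eventually (\<lambda>n. \<not> P n) U"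
    and s: "\<And>n. (\<lambda>i. s i n) \<in> assignments M"
  shows "sat ultrapower (\<lambda>i. ultra_repr (s i)) \<phi> \<longleftrightarrow> eventually (\<lambda>n. sat M (\<lambda>i. s i n) \<phi>) U"
  using s
proof (induction \<phi> arbitrary: s)
  case (Eq t t')
  have "range (\<lambda>n. tm_val M (\<lambda>i. s i n) t) \<subseteq> univ M" for t
    using tm_val_closed[OF M Eq] by blast
  then show ?case by (simp add: tm_val_ultrapower[OF M Eq] ultra_repr_eq_iff)
next
  case (Dvd t t')
  let ?f = "\<lambda>t n. tm_val M (\<lambda>i. s i n) t"
  have r: "eventually (\<lambda>n. ultra_repr (?f t) n = ?f t n) U" for t
    using tm_val_closed[OF M Dvd] by (intro ultra_repr(2)) blast
  have "eventually (\<lambda>n. dvd_rel M (ultra_repr (?f t) n) (ultra_repr (?f t') n) \<longleftrightarrow>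
      dvd_rel M (?f t n) (?f t' n)) U"
    using eventually_conj[OF r[of t] r[of t']] by (rule eventually_mono) simp
  moreover have "dvd_rel ultrapower f g \<longleftrightarrow> eventually (\<lambda>n. dvd_rel M (f n) (g n)) U" for f g
    by (simp add: ultrapower_def)
  ultimately show ?case by (simp add: tm_val_ultrapower[OF M Dvd] eventually_subst)
next
  case (Neg \<phi>)
  have "\<not> eventually P U \<longleftrightarrow> eventually (\<lambda>n. \<not> P n) U" for P
    using U(2)[of P] U(1) eventually_conj[of P U "\<lambda>n. \<not> P n"] by auto
  then show ?case using Neg.IH[OF Neg.prems] by simp
next
  case (Conj \<phi> \<psi>)
  then show ?case by (simp add: eventually_conj_iff)
next
  case (Ex i \<phi>)
  have upd: "(\<lambda>j. ultra_repr (s j))(i := ultra_repr f) = (\<lambda>j. ultra_repr ((s(i := f)) j))"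
    "(\<lambda>j. (s(i := f)) j n) = (\<lambda>j. s j n)(i := f n)" for f n by auto
  have IH: "sat ultrapower ((\<lambda>j. ultra_repr (s j))(i := ultra_repr f)) \<phi> \<longleftrightarrow>
      eventually (\<lambda>n. sat M ((\<lambda>j. s j n)(i := f n)) \<phi>) U" if "range f \<subseteq> univ M" for f
    unfolding upd(1)
  proof (subst Ex.IH)
    show "(\<lambda>j. (s(i := f)) j n) \<in> assignments M" for n
      unfolding upd(2) using that by (intro assignments_upd Ex.prems) auto
  qed (simp only: upd(2))
  show ?case
  proof
    assume "sat ultrapower (\<lambda>i. ultra_repr (s i)) (Ex i \<phi>)"
    then obtain f where f: "range f \<subseteq> univ M"
      "sat ultrapower ((\<lambda>j. ultra_repr (s j))(i := ultra_repr f)) \<phi>"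
      by (auto simp: ultrapower_def)
    then have "eventually (\<lambda>n. sat M ((\<lambda>j. s j n)(i := f n)) \<phi>) U" using IH by blast
    then show "eventually (\<lambda>n. sat M (\<lambda>i. s i n) (Ex i \<phi>)) U"
      by (rule eventually_mono) (use f(1) in auto)
  next
    assume *: "eventually (\<lambda>n. sat M (\<lambda>i. s i n) (Ex i \<phi>)) U"
    \<comment> \<open>Coordinates without a witness receive an arbitrary element of the nonempty
      universe.\<close>
    have "\<exists>b. b \<in> univ M \<and> (sat M (\<lambda>i. s i n) (Ex i \<phi>) \<longrightarrow> sat M ((\<lambda>j. s j n)(i := b)) \<phi>)" for n
      using M unfolding is_structure_def sat.simps by blast
    then obtain f where f: "\<And>n. f n \<in> univ M"
      "\<And>n. sat M (\<lambda>i. s i n) (Ex i \<phi>) \<Longrightarrow> sat M ((\<lambda>j. s j n)(i := f n)) \<phi>" by metis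
    have "eventually (\<lambda>n. sat M ((\<lambda>j. s j n)(i := f n)) \<phi>) U"
      using * by (rule eventually_mono) (rule f(2))
    then have "sat ultrapower ((\<lambda>j. ultra_repr (s j))(i := ultra_repr f)) \<phi>"
      using IH[of f] f(1) by blast
    moreover have "ultra_repr f \<in> univ ultrapower" using f(1) by (auto simp: ultrapower_def)
    ultimately show "sat ultrapower (\<lambda>i. ultra_repr (s i)) (Ex i \<phi>)" by auto
  qed
qed

end

section \<open>Uniform definability\<close>

text \<open>Directedness is assumed only for models on the type \<open>'m\<close>, whereas
  \<open>M\<close> may live elsewhere. A failure involves just two parameter tuples and three
  points, a countable set that a countable elementary substructure carries into
  \<open>'m\<close>.\<close>

lemma directed_formulas_in_structure:
  assumes M: "is_structure M" and \<Psi>: "directed_formulas TYPE('m::infinite) (complete_theory M) \<Psi>"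
  shows "directed_family {instance_set M \<psi> a | \<psi> a. \<psi> \<in> \<Psi> \<and> a \<in> assignments M}"
proof -
  have "instance_set M \<psi> a \<subseteq> instance_set M \<psi>' a' \<or> instance_set M \<psi>' a' \<subseteq> instance_set M \<psi> a \<or>
      instance_set M \<psi> a \<inter> instance_set M \<psi>' a' = {}"
    if ass: "\<psi> \<in> \<Psi>" "\<psi>' \<in> \<Psi>" "a \<in> assignments M" "a' \<in> assignments M" for \<psi> \<psi>' a a'
  proof (rule ccontr)
    assume "\<not> ?thesis"
    then obtain p q r where p: "p \<in> instance_set M \<psi> a" "p \<notin> instance_set M \<psi>' a'"
      and q: "q \<in> instance_set M \<psi>' a'" "q \<notin> instance_set M \<psi> a"
      and r: "r \<in> instance_set M \<psi> a" "r \<in> instance_set M \<psi>' a'" by blast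
    let ?C = "range a \<union> range a' \<union> {p, q, r}"
    have C: "countable ?C" "?C \<subseteq> univ M" using ass p q r by (auto simp: instance_set_def assignments_def)
    obtain N :: "'m struct" and h where N: "is_structure N" "elementary_embedding N M h"
      "?C \<subseteq> h ` univ N" by (rule downward_loewenheim_skolem[OF M C])
    have mem: "b \<in> instance_set N \<chi> c \<longleftrightarrow> h b \<in> instance_set M \<chi> (h \<circ> c)"
      if "b \<in> univ N" "c \<in> assignments N" for b c \<chi>
    proof -
      have "h \<circ> c(0 := b) = (h \<circ> c)(0 := h b)" by auto
      then show ?thesis using N(2) that assignments_upd[OF that(2,1), of 0]
        by (auto simp: instance_set_def holds_at_def elementary_embedding_def)
    qed
    have pull: "\<exists>c\<in>assignments N. h \<circ> c = e" if "range e \<subseteq> h ` univ N" for e :: "nat \<Rightarrow> 'a"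
    proof -
      have "\<forall>i. \<exists>x. x \<in> univ N \<and> h x = e i" using that by (metis imageE range_subsetD)
      then obtain c where "\<And>i. c i \<in> univ N \<and> h (c i) = e i" by metis
      then show ?thesis by (intro bexI[of _ c]) (auto simp: assignments_def)
    qed
    obtain c c' where c: "c \<in> assignments N" "h \<circ> c = a" "c' \<in> assignments N" "h \<circ> c' = a'"
      using pull[of a] pull[of a'] N(3) by auto
    obtain x y z where x: "x \<in> univ N" "h x = p" "y \<in> univ N" "h y = q" "z \<in> univ N" "h z = r"
      using N(3) by auto
    have "directed_family {instance_set N \<psi> a | \<psi> a. \<psi> \<in> \<Psi> \<and> a \<in> assignments N}"
      using \<Psi> elementary_embedding_model[OF N(2,1)] by (simp add: directed_formulas_def)
    then have "instance_set N \<psi> c \<subseteq> instance_set N \<psi>' c' \<or> instance_set N \<psi>' c' \<subseteq> instance_set N \<psi> c \<or>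
      instance_set N \<psi> c \<inter> instance_set N \<psi>' c' = {}"
      using ass c unfolding directed_family_def by blast
    moreover have "x \<in> instance_set N \<psi> c" "x \<notin> instance_set N \<psi>' c'"
      "y \<in> instance_set N \<psi>' c'" "y \<notin> instance_set N \<psi> c"
      "z \<in> instance_set N \<psi> c" "z \<in> instance_set N \<psi>' c'"
      using mem c x p q r by auto
    ultimately show False by blast
  qed
  then show ?thesis unfolding directed_family_def by blast
qed

text \<open>If no finite set of shapes suffices, then the diagonal element of an ultrapower built from
  parameters refuting more and more shapes refutes all of them, and it lies in a model
  of the kind considered in the definition of quasi-VC-minimality.\<close>

lemma quasi_VC_minimal_uniform:
  fixes M :: "'n struct"
  assumes M: "is_structure M" and "quasi_VC_minimal TYPE('m::infinite) (complete_theory M)"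
  shows "\<exists>\<Psi>. directed_family {instance_set M \<psi> a | \<psi> a. \<psi> \<in> \<Psi> \<and> a \<in> assignments M} \<and>
    (\<forall>\<phi>. \<exists>S. finite S \<and> (\<forall>\<sigma>\<in>S. \<forall>\<psi>\<in>fst ` set_bool_comb \<sigma>. \<psi> \<in> \<Psi> \<or> free_vars \<psi> \<subseteq> {0}) \<and>
      (\<forall>a\<in>assignments M. \<exists>\<sigma>\<in>S. \<exists>e\<in>assignments M. \<forall>b\<in>univ M.
        holds_at M \<phi> a b \<longleftrightarrow> holds_at M (comb_fm \<sigma>) e b))"
proof -
  obtain \<Psi> where dir: "directed_formulas TYPE('m) (complete_theory M) \<Psi>"
    and def: "\<And>(N :: 'm struct) \<phi> a. is_model N (complete_theory M) \<Longrightarrow> a \<in> assignments N \<Longrightarrow>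
      \<exists>\<beta>. set_bool_comb \<beta> \<subseteq> {(\<psi>, c). c \<in> assignments N \<and> (\<psi> \<in> \<Psi> \<or> free_vars \<psi> \<subseteq> {0})} \<and>
        (\<forall>b\<in>univ N. holds_at N \<phi> a b \<longleftrightarrow> bool_comb_holds (\<lambda>(\<psi>, c). holds_at N \<psi> c b) \<beta>)"
    using assms(2) unfolding quasi_VC_minimal_def by blast
  define Sh where "Sh = {\<sigma> :: (fm \<times> nat) bool_comb. \<forall>\<psi>\<in>fst ` set_bool_comb \<sigma>. \<psi> \<in> \<Psi> \<or> free_vars \<psi> \<subseteq> {0}}"
  have shapes: "\<exists>S. finite S \<and> S \<subseteq> Sh \<and> (\<forall>a\<in>assignments M. \<exists>\<sigma>\<in>S. \<exists>e\<in>assignments M.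
      sat M (join2 a e) (equiv_fm \<phi> (comb_fm \<sigma>)))" for \<phi>
  proof (rule ccontr)
    assume neg: "\<not> ?thesis"
    \<comment> \<open>Coding shapes by natural numbers makes the \<open>S n\<close> finite sets
      exhausting \<open>Sh\<close>. By \<open>neg\<close> each leaves a parameter tuple
      \<open>a n\<close> that none of its shapes fits.\<close>
    define S where "S n = {\<sigma> \<in> Sh. to_nat \<sigma> \<le> n}" for n
    have "finite (S n)" for n
    proof -
      have "S n \<subseteq> from_nat ` {..n}" by (force simp: S_def)
      then show ?thesis by (rule finite_subset) simp
    qed
    then have "\<exists>a\<in>assignments M. \<forall>\<sigma>\<in>S n. \<forall>e\<in>assignments M.
        \<not> sat M (join2 a e) (equiv_fm \<phi> (comb_fm \<sigma>))" for n
      using neg[simplified, rule_format, of "S n"] by (auto simp: S_def)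
    then obtain a where a: "\<And>n. a n \<in> assignments M"
      and bad: "\<And>n \<sigma> e. \<sigma> \<in> S n \<Longrightarrow> e \<in> assignments M \<Longrightarrow>
        \<not> sat M (join2 (a n) e) (equiv_fm \<phi> (comb_fm \<sigma>))" by metis
    obtain U :: "nat filter" where U: "U \<noteq> bot" "U \<le> sequentially"
      "\<And>P. eventually P U \<or> eventually (\<lambda>n. \<not> P n) U" using nonprincipal_ultrafilter by blast
    let ?P = "ultrapower M U" and ?r = "ultra_repr M U"
    \<comment> \<open>The diagonal tuple, represented coordinatewise by the \<open>a n\<close>. The
      ultrapower consists of sequences, so a countable elementary substructure around
      \<open>A\<close> is moved into the type \<open>'m\<close>.\<close>
    define A where "A i = ?r (\<lambda>n. a n i)" for i
    have A: "countable (range A)" "range A \<subseteq> univ ?P" using a by (auto simp: A_def ultrapower_def assignments_def)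
    obtain N :: "'m struct" and h where N: "is_structure N" "elementary_embedding N ?P h"
      "range A \<subseteq> h ` univ N"
      by (rule downward_loewenheim_skolem[OF ultrapower_structure[OF M] A])
    have "\<forall>i. \<exists>x. x \<in> univ N \<and> h x = A i" using N(3) by (metis imageE range_subsetD)
    then obtain a' where a': "\<And>i. a' i \<in> univ N \<and> h (a' i) = A i" by metis
    then have a'N: "a' \<in> assignments N" by (auto simp: assignments_def)
    \<comment> \<open>By Los's theorem the ultrapower satisfies the theory of \<open>M\<close>, and
      so does its elementary substructure.\<close>
    have T: "complete_theory M \<subseteq> complete_theory ?P"
    proof
      fix \<chi> assume \<chi>: "\<chi> \<in> complete_theory M"
      have "sat ?P e \<chi>" if "e \<in> assignments ?P" for e
      proof -
        have "\<forall>i. \<exists>f. range f \<subseteq> univ M \<and> e i = ?r f"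
          using assignmentsD[OF that] by (intro allI univ_ultrapowerD)
        then obtain s where s: "\<And>i. range (s i) \<subseteq> univ M \<and> e i = ?r (s i)" by metis
        then have "(\<lambda>i. s i n) \<in> assignments M" for n by (auto simp: assignments_def)
        moreover have "e = (\<lambda>i. ?r (s i))" using s by auto
        ultimately show ?thesis
          using \<chi> los[OF M U(1,3), of s \<chi>] by (simp add: complete_theory_def)
      qed
      then show "\<chi> \<in> complete_theory ?P" using \<chi> by (simp add: complete_theory_def)
    qed
    have "is_model N (complete_theory M)"
      using elementary_embedding_model[OF N(2,1)] T by (auto simp: is_model_def)
    then obtain \<beta> where \<beta>: "set_bool_comb \<beta> \<subseteq> {(\<psi>, c). c \<in> assignments N \<and> (\<psi> \<in> \<Psi> \<or> free_vars \<psi> \<subseteq> {0})}"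
      "\<forall>b\<in>univ N. holds_at N \<phi> a' b \<longleftrightarrow> bool_comb_holds (\<lambda>(\<psi>, c). holds_at N \<psi> c b) \<beta>"
      using def a'N by blast
    obtain \<sigma> e where e: "e \<in> assignments N" and \<sigma>: "fst ` set_bool_comb \<sigma> = fst ` set_bool_comb \<beta>"
      and \<sigma>\<beta>: "\<And>b. sat N (e(0 := b)) (comb_fm \<sigma>) \<longleftrightarrow> bool_comb_holds (\<lambda>(\<psi>, c). holds_at N \<psi> c b) \<beta>"
    proof -
      have "snd ` set_bool_comb \<beta> \<subseteq> assignments N" using \<beta>(1) by auto
      then show ?thesis using bool_comb_shape[of \<beta> N] a'N that by blast
    qed
    have "\<sigma> \<in> Sh" unfolding Sh_def mem_Collect_eq \<sigma>
    proof
      fix \<psi> assume "\<psi> \<in> fst ` set_bool_comb \<beta>"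
      then obtain p where "p \<in> set_bool_comb \<beta>" and p: "\<psi> = fst p" by blast
      with \<beta>(1) have "p \<in> {(\<psi>, c). c \<in> assignments N \<and> (\<psi> \<in> \<Psi> \<or> free_vars \<psi> \<subseteq> {0})}"
        by blast
      then show "\<psi> \<in> \<Psi> \<or> free_vars \<psi> \<subseteq> {0}" unfolding p by (simp only: split_beta mem_Collect_eq)
    qed
    have "sat N (join2 a' e) (equiv_fm \<phi> (comb_fm \<sigma>))"
      using \<beta>(2) \<sigma>\<beta> by (simp add: sat_equiv_fm holds_at_def)
    then have sP: "sat ?P (join2 A (h \<circ> e)) (equiv_fm \<phi> (comb_fm \<sigma>))"
    proof -
      have "h \<circ> a' = A" using a' by auto
      then have "h \<circ> join2 a' e = join2 A (h \<circ> e)" by (simp add: join2_map)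
      then show ?thesis using N(2) join2_assignments[OF a'N e] \<open>sat N _ _\<close>
        by (auto simp: elementary_embedding_def)
    qed
    \<comment> \<open>The parameters found in \<open>N\<close> are represented by sequences
      \<open>s\<close> in \<open>M\<close>. Los's theorem then says that for almost all
      \<open>n\<close> the shape \<open>\<sigma>\<close> fits \<open>a n\<close>, with parameters
      given by coordinate \<open>n\<close> of \<open>s\<close>.\<close>
    have "\<forall>i. \<exists>f. range f \<subseteq> univ M \<and> h (e i) = ?r f"
      using assignmentsD[OF elementary_embedding_assignments[OF N(2) e]]
      by (intro allI univ_ultrapowerD) simp
    then obtain s where s: "\<And>i. range (s i) \<subseteq> univ M \<and> h (e i) = ?r (s i)" by metis
    then have sM: "(\<lambda>i. s i n) \<in> assignments M" for n by (auto simp: assignments_def)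
    define G where "G = join2 (\<lambda>i n. a n i) s"
    have G: "(\<lambda>i. G i n) = join2 (a n) (\<lambda>i. s i n)" for n
      using join2_map[of "\<lambda>f. f n" "\<lambda>i n. a n i" s] by (simp add: G_def comp_def)
    have "join2 A (h \<circ> e) = (\<lambda>i. ?r (G i))"
      using join2_map[of ?r "\<lambda>i n. a n i" s] s by (simp add: G_def comp_def A_def[abs_def])
    then have "eventually (\<lambda>n. sat M (join2 (a n) (\<lambda>i. s i n)) (equiv_fm \<phi> (comb_fm \<sigma>))) U"
      using sP los[OF M U(1,3), of G] join2_assignments[OF a sM] by (simp add: G)
    \<comment> \<open>From index \<open>to_nat \<sigma>\<close> on, \<open>\<sigma>\<close> lies in
      \<open>S n\<close>, and \<open>U\<close> refines \<open>sequentially\<close>. So some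
      \<open>a n\<close> is fitted by a shape it was chosen to refute.\<close>
    moreover have "eventually (\<lambda>n. to_nat \<sigma> \<le> n) U"
      using U(2) by (simp add: le_sequentially)
    ultimately have "eventually (\<lambda>_. False) U"
      by eventually_elim (use bad sM \<open>\<sigma> \<in> Sh\<close> in \<open>auto simp: S_def\<close>)
    then show False using U(1) by simp
  qed
  have "\<exists>S. finite S \<and> (\<forall>\<sigma>\<in>S. \<forall>\<psi>\<in>fst ` set_bool_comb \<sigma>. \<psi> \<in> \<Psi> \<or> free_vars \<psi> \<subseteq> {0}) \<and>
      (\<forall>a\<in>assignments M. \<exists>\<sigma>\<in>S. \<exists>e\<in>assignments M. \<forall>b\<in>univ M.
        holds_at M \<phi> a b \<longleftrightarrow> holds_at M (comb_fm \<sigma>) e b)" for \<phi>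
  proof -
    obtain S where S: "finite S" "S \<subseteq> Sh" "\<forall>a\<in>assignments M. \<exists>\<sigma>\<in>S. \<exists>e\<in>assignments M.
        sat M (join2 a e) (equiv_fm \<phi> (comb_fm \<sigma>))" using shapes[of \<phi>] by blast
    show ?thesis
    proof (intro exI[of _ S] conjI)
      show "\<forall>\<sigma>\<in>S. \<forall>\<psi>\<in>fst ` set_bool_comb \<sigma>. \<psi> \<in> \<Psi> \<or> free_vars \<psi> \<subseteq> {0}"
        using S(2) unfolding Sh_def by blast
    qed (use S(1,3) in \<open>simp_all only: sat_equiv_fm holds_at_def\<close>)
  qed
  then show ?thesis using directed_formulas_in_structure[OF M dir] by blast
qed

section \<open>Alternations along a list\<close>

fun alternations :: "('a \<Rightarrow> bool) \<Rightarrow> 'a list \<Rightarrow> nat" where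
  "alternations P (x # y # zs) = of_bool (P x \<noteq> P y) + alternations P (y # zs)"
| "alternations P _ = 0"

text \<open>The common head \<open>x\<close> strengthens the induction for the case of
  \<open>alternations_subseq\<close> in which both lists keep their first entry.\<close>

lemma alternations_Cons_mono:
  "subseq xs ys \<Longrightarrow> alternations P (x # xs) \<le> alternations P (x # ys)"
proof (induction arbitrary: x rule: list_emb.induct)
  case (list_emb_Cons xs ys y)
  have "alternations P (x # ys) \<le> alternations P (x # y # ys)" by (cases ys) auto
  with list_emb_Cons.IH[of x] show ?case by (rule le_trans)
qed auto

lemma alternations_subseq: "subseq xs ys \<Longrightarrow> alternations P xs \<le> alternations P ys"
proof (induction rule: list_emb.induct)
  case (list_emb_Cons xs ys y)
  have "alternations P ys \<le> alternations P (y # ys)" by (cases ys) auto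
  with list_emb_Cons.IH show ?case by (rule le_trans)
next
  case (list_emb_Cons2 x y xs ys)
  then show ?case by (auto intro: alternations_Cons_mono)
qed simp

lemma alternations_append:
  "alternations P (xs @ y # zs) = alternations P (xs @ [y]) + alternations P (y # zs)"
  by (induction P xs rule: alternations.induct) (auto split: list.splits)

text \<open>If \<open>y\<close> has two neighbours, both differ from it and hence agree, so two
  alternations replace none. At an end of the list exactly one is added.\<close>

lemma alternations_insert:
  assumes "ys @ zs \<noteq> []"
    and "ys \<noteq> [] \<Longrightarrow> P (last ys) \<noteq> P y" and "zs \<noteq> [] \<Longrightarrow> P (hd zs) \<noteq> P y"
  shows "alternations P (ys @ zs) < alternations P (ys @ y # zs)"
proof -
  have 1: "alternations P (us @ [u, y]) = alternations P (us @ [u]) + of_bool (P u \<noteq> P y)" for us u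
    using alternations_append[of P us u "[y]"] by simp
  show ?thesis
  proof (cases ys rule: rev_cases)
    case Nil
    then show ?thesis using assms by (cases zs) auto
  next
    case (snoc us u)
    show ?thesis
    proof (cases zs)
      case Nil
      then show ?thesis using snoc assms 1 by simp
    next
      case (Cons w ws)
      have "alternations P (ys @ zs) = alternations P (us @ [u]) + alternations P (u # zs)"
        using snoc alternations_append[of P us u zs] by simp
      moreover have "alternations P (ys @ y # zs) = alternations P (us @ [u]) + alternations P (u # y # zs)"
        using snoc alternations_append[of P us u "y # zs"] by simp
      ultimately show ?thesis using assms snoc Cons by auto
    qed
  qed
qed

lemma alternations_le_if_implied:
  assumes "\<And>x y. x \<in> set xs \<Longrightarrow> y \<in> set xs \<Longrightarrow> P x = P y \<Longrightarrow> Q x = Q y"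
  shows "alternations Q xs \<le> alternations P xs"
  using assms by (induction P xs rule: alternations.induct) auto

text \<open>Where the combination changes, \<open>P\<close> or \<open>Q\<close> must change.\<close>

lemma alternations_binop:
  "alternations (\<lambda>x. f (P x) (Q x)) xs \<le> alternations P xs + alternations Q xs"
  by (induction P xs rule: alternations.induct) auto

lemma alternations_constant:
  "(\<And>x y. x \<in> set xs \<Longrightarrow> y \<in> set xs \<Longrightarrow> P x = P y) \<Longrightarrow> alternations P xs = 0"
  by (induction P xs rule: alternations.induct) auto

lemma alternations_constant_block:
  assumes "\<And>x. x \<in> set bs \<Longrightarrow> P x = P b"
  shows "alternations P (ys @ b # bs @ zs) = alternations P (ys @ b # zs)"
proof -
  have "alternations P (b # bs @ zs) = alternations P (b # zs)"
    using assms by (induction bs arbitrary: b) (cases zs; force)+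
  then show ?thesis by (metis alternations_append)
qed

section \<open>Linear orders adapted to directed families\<close>

text \<open>Gathering the points of a minimal member of the family at the position of one of them
  makes this member convex and keeps the others convex.\<close>

lemma directed_family_convex_enumeration:
  assumes "finite F" "directed_family F" "finite X"
  shows "\<exists>xs. set xs = X \<and> (\<forall>A\<in>F. alternations (\<lambda>x. x \<in> A) xs \<le> 2)"
  using assms
proof (induction "card F" arbitrary: F rule: less_induct)
  case less
  show ?case
  proof (cases "\<exists>A\<in>F. A \<inter> X \<noteq> {}")
    case False
    obtain xs where xs: "set xs = X" using finite_list[OF \<open>finite X\<close>] by blast
    have "alternations (\<lambda>x. x \<in> A) xs = 0" if "A \<in> F" for A
      by (rule alternations_constant) (use False that xs in blast)
    with xs show ?thesis by (intro exI[of _ xs]) simp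
  next
    case True
    let ?G = "{A \<in> F. A \<inter> X \<noteq> {}}"
    \<comment> \<open>Minimality refers to the trace on \<open>X\<close>, among the members that
      meet \<open>X\<close>.\<close>
    obtain A where A: "A \<in> ?G" and min: "\<And>B. B \<in> ?G \<Longrightarrow> card (A \<inter> X) \<le> card (B \<inter> X)"
      using ex_has_least_nat[of "\<lambda>A. A \<in> ?G" _ "\<lambda>A. card (A \<inter> X)"] True by blast
    have "card (F - {A}) < card F" using A less.prems by (intro psubset_card_mono) auto
    moreover have "directed_family (F - {A})"
      using less.prems(2) unfolding directed_family_def by blast
    ultimately obtain xs where xs: "set xs = X"
      and conv: "\<And>B. B \<in> F - {A} \<Longrightarrow> alternations (\<lambda>x. x \<in> B) xs \<le> 2"
      using less.hyps[of "F - {A}"] less.prems by auto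
    obtain b where b: "b \<in> A" "b \<in> X" using A by auto
    obtain ys zs where split: "xs = ys @ b # zs" using b xs by (metis split_list)
    \<comment> \<open>The list \<open>bs\<close> contains \<open>b\<close> again; repetitions are
      harmless, since only the set of entries is prescribed.\<close>
    obtain bs where bs: "set bs = A \<inter> X" using finite_list \<open>finite X\<close> by blast
    define out where "out = filter (\<lambda>x. x \<notin> A)"
    let ?xs = "out ys @ b # bs @ out zs"
    have set: "set ?xs = X" using xs b bs unfolding split out_def by auto
    have block: "x \<in> B \<longleftrightarrow> b \<in> B" if "B \<in> F" "x \<in> set bs" for x B
    proof -
      have "A \<subseteq> B \<or> B \<subseteq> A \<or> A \<inter> B = {}"
        using less.prems(2) A that(1) by (simp add: directed_family_def)
      moreover have "x \<in> A" using that(2) bs by simp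
      ultimately consider "x \<in> B" "b \<in> B" | "B \<subseteq> A" "b \<in> B \<or> x \<in> B" | "b \<notin> B" "x \<notin> B"
        using b by blast
      then show ?thesis
      proof cases
        \<comment> \<open>A member inside \<open>A\<close> that meets \<open>X\<close> has, by
          minimality, the same trace on \<open>X\<close> as \<open>A\<close>.\<close>
        case 2
        then have "B \<in> ?G" using that b bs by auto
        then have "B \<inter> X = A \<inter> X"
          using min[of B] 2 \<open>finite X\<close> by (intro card_seteq) auto
        then show ?thesis using that b bs by auto
      qed (use that b bs in auto)
    qed
    have "alternations (\<lambda>x. x \<in> B) ?xs \<le> 2" if "B \<in> F" for B
    proof -
      \<comment> \<open>No member separates the points of the block, so it collapses to
        \<open>b\<close>. What remains is a subsequence of \<open>xs\<close>, to which the induction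
        hypothesis applies when \<open>B\<close> is not \<open>A\<close>; for \<open>A\<close>
        itself only the two ends of the block count.\<close>
      have 1: "alternations (\<lambda>x. x \<in> B) ?xs = alternations (\<lambda>x. x \<in> B) (out ys @ b # out zs)"
        using block[OF that] by (intro alternations_constant_block) blast
      show ?thesis
      proof (cases "B = A")
        case True
        have "alternations (\<lambda>x. x \<in> A) (out ys @ [b]) \<le> 1"
        proof -
          have "alternations (\<lambda>x. x \<in> A) (us @ [b]) \<le> 1" if "\<forall>x\<in>set us. x \<notin> A" for us
            using that by (induction "\<lambda>x. x \<in> A" us rule: alternations.induct) auto
          then show ?thesis by (simp add: out_def)
        qed
        moreover have "alternations (\<lambda>x. x \<in> A) (b # out zs) \<le> 1"
        proof -
          have "alternations (\<lambda>x. x \<in> A) (out zs) = 0"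
            by (rule alternations_constant) (simp add: out_def)
          then show ?thesis by (cases "out zs") auto
        qed
        ultimately show ?thesis
          using 1 True alternations_append[of "\<lambda>x. x \<in> A" "out ys" b "out zs"] by simp
      next
        case False
        have "subseq (out ys @ b # out zs) xs"
          unfolding split out_def by (intro list_emb_append_mono subseq_Cons2 subseq_filter_left)
        then have "alternations (\<lambda>x. x \<in> B) (out ys @ b # out zs) \<le> 2"
          using alternations_subseq conv[of B] False that by (metis DiffI le_trans singletonD)
        then show ?thesis using 1 by simp
      qed
    qed
    with set show ?thesis by blast
  qed
qed

section \<open>Ternary trees forcing many alternations\<close>

text \<open>Finite trees in which the level at which two leaves part decides whether they are related;
  the levels alternate.\<close>

primrec alternating_tree :: "('a \<Rightarrow> 'a \<Rightarrow> bool) \<Rightarrow> nat \<Rightarrow> 'a set \<Rightarrow> bool" where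
  "alternating_tree R 0 X \<longleftrightarrow> (\<exists>a. X = {a})"
| "alternating_tree R (Suc h) X \<longleftrightarrow> (\<exists>Y :: nat \<Rightarrow> 'a set. X = (\<Union>i<3. Y i) \<and>
     (\<forall>i<3. alternating_tree R h (Y i)) \<and>
     (\<forall>i<3. \<forall>j<3. i \<noteq> j \<longrightarrow> Y i \<inter> Y j = {} \<and> (\<forall>x\<in>Y i. \<forall>y\<in>Y j. R x y \<longleftrightarrow> odd h)))"

lemma alternating_tree_nonempty: "alternating_tree R h X \<Longrightarrow> X \<noteq> {}"
  by (induction h arbitrary: X) fastforce+

lemma alternating_tree_finite: "alternating_tree R h X \<Longrightarrow> finite X"
  by (induction h arbitrary: X) auto

text \<open>Descend into a child avoiding the children of \<open>u\<close> and \<open>w\<close>. A point \<open>y\<close> outside this child is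
  enumerated between two of its leaves, which serve as the next \<open>u\<close> and \<open>w\<close>, and \<open>y\<close>
  causes an additional alternation.\<close>

lemma alternating_tree_alternations:
  assumes refl: "\<And>a. R a a"
  shows "alternating_tree R h X \<Longrightarrow> set xs = X \<Longrightarrow> u \<in> X \<Longrightarrow> w \<in> X \<Longrightarrow>
    \<exists>a\<in>X. h \<le> alternations (R a) xs \<and> (R a u \<longleftrightarrow> even h) \<and> (R a w \<longleftrightarrow> even h)"
proof (induction h arbitrary: X xs u w)
  case 0
  then show ?case using refl by auto
next
  case (Suc h)
  obtain Y :: "nat \<Rightarrow> 'a set" where X: "X = (\<Union>i<3. Y i)"
    and tree: "\<And>i. i < 3 \<Longrightarrow> alternating_tree R h (Y i)"
    and disj: "\<And>i j. i < 3 \<Longrightarrow> j < 3 \<Longrightarrow> i \<noteq> j \<Longrightarrow> Y i \<inter> Y j = {}"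
    and rel: "\<And>i j x y. i < 3 \<Longrightarrow> j < 3 \<Longrightarrow> i \<noteq> j \<Longrightarrow> x \<in> Y i \<Longrightarrow> y \<in> Y j \<Longrightarrow> R x y \<longleftrightarrow> odd h"
    using Suc.prems(1) by auto
  obtain i j where ij: "i < 3" "u \<in> Y i" "j < 3" "w \<in> Y j" using Suc.prems X by auto
  \<comment> \<open>Three children are needed here: \<open>u\<close> and \<open>w\<close> may occupy
    two of them.\<close>
  obtain k where k: "k < 3" "k \<noteq> i" "k \<noteq> j"
  proof -
    have "card {i, j} < card {..<3::nat}" by (simp add: card_insert_if)
    then have "\<not> {..<3} \<subseteq> {i, j}" by (metis card_mono finite.intros leD)
    then show ?thesis using that by auto
  qed
  obtain y where y: "y \<in> Y i" using ij by blast
  then have yk: "y \<notin> Y k" using disj[of i k] ij k by blast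
  have "y \<in> set xs" using y ij X Suc.prems by auto
  then obtain ys zs where split: "xs = ys @ y # zs" by (metis split_list)
  define us where "us = filter (\<lambda>x. x \<in> Y k) ys"
  define ws where "ws = filter (\<lambda>x. x \<in> Y k) zs"
  have "us @ ws = filter (\<lambda>x. x \<in> Y k) xs" using yk by (simp add: us_def ws_def split)
  then have set: "set (us @ ws) = Y k" using Suc.prems k X by auto
  then have ne: "us @ ws \<noteq> []" using alternating_tree_nonempty[OF tree[OF k(1)]] by force
  \<comment> \<open>These are the neighbours of \<open>y\<close> among the leaves of the child. If
    one side is empty, both denote the neighbour on the other side.\<close>
  define u' where "u' = (if us = [] then hd ws else last us)"
  define w' where "w' = (if ws = [] then last us else hd ws)"
  have "u' \<in> set (us @ ws)" "w' \<in> set (us @ ws)"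
    using ne by (auto simp: u'_def w'_def)
  then obtain a where a: "a \<in> Y k" "h \<le> alternations (R a) (us @ ws)"
    "R a u' \<longleftrightarrow> even h" "R a w' \<longleftrightarrow> even h"
    using Suc.IH[OF tree[OF k(1)] set] set by blast
  have Ry: "R a y \<longleftrightarrow> odd h" using rel[OF k(1) ij(1)] k a y by blast
  have "alternations (R a) (us @ ws) < alternations (R a) (us @ y # ws)"
    using a Ry ne by (intro alternations_insert) (auto simp: u'_def w'_def)
  also have "\<dots> \<le> alternations (R a) xs"
    unfolding split us_def ws_def
    by (intro alternations_subseq list_emb_append_mono subseq_Cons2 subseq_filter_left)
  finally have "Suc h \<le> alternations (R a) xs" using a by simp
  moreover have "a \<in> X" using a k X by auto
  \<comment> \<open>Both \<open>u\<close> and \<open>w\<close> lie in other children than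
    \<open>a\<close>, so the top level decides these relations; they keep the invariant for the
    level above.\<close>
  moreover have "R a u \<longleftrightarrow> odd h" "R a w \<longleftrightarrow> odd h" using rel a k ij by blast+
  ultimately show ?case by auto
qed

section \<open>Trees in valued fields\<close>

lemma Fin_order [simp]:
  "Fin g \<le> Fin h \<longleftrightarrow> g \<le> h" "Fin g < Fin h \<longleftrightarrow> g < h" "Fin g < Infty" "x \<le> Infty"
  by (auto simp: less_eq_with_infty_def less_with_infty_def split: with_infty.splits)

lemma with_infty_plus [simp]: "Fin g + Fin h = Fin (g + h)" "Infty + x = Infty" "x + Infty = Infty"
  by (auto simp: plus_with_infty_def split: with_infty.splits)

text \<open>The sequence runs through the coset of \<open>s\<close> modulo n\<Gamma>, where
  \<open>s\<close> is \<open>0\<close> or \<open>g\<^sub>0\<close> according to \<open>b\<close>;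
  adding n-fold multiples of a large positive \<open>t\<close> makes it increase from above
  \<open>\<rho>\<close>.\<close>

lemma unbounded_coset_sequence:
  fixes g\<^sub>0 \<rho> :: "'g::linordered_ab_group_add" and n :: nat
  assumes n: "n \<ge> 1" and g\<^sub>0: "g\<^sub>0 \<notin> range (\<lambda>g::'g. \<Sum>i<n. g)"
  shows "\<exists>\<delta> :: nat \<Rightarrow> 'g. strict_mono \<delta> \<and> (\<forall>i. \<rho> < \<delta> i) \<and>
    (\<forall>i. \<delta> i \<in> range (\<lambda>g. \<Sum>i<n. g) \<longleftrightarrow> b)"
proof -
  define r where "r = max \<rho> 0"
  define p where "p = max g\<^sub>0 (- g\<^sub>0)"
  define t where "t = r + p"
  have "g\<^sub>0 \<noteq> 0"
  proof
    assume "g\<^sub>0 = 0"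
    then have "g\<^sub>0 = (\<Sum>i<n. 0)" by simp
    with g\<^sub>0 show False by blast
  qed
  then have "0 < p" by (auto simp: p_def less_max_iff_disj)
  moreover have r: "0 \<le> r" "\<rho> \<le> r" by (auto simp: r_def)
  ultimately have t: "0 < t" unfolding t_def by (intro add_nonneg_pos)
  define s where "s = (if b then 0 else g\<^sub>0)"
  \<comment> \<open>Starting with two copies of \<open>t\<close> absorbs both \<open>s\<close> and
    \<open>\<rho>\<close>: as \<open>p\<close> is the absolute value of \<open>g\<^sub>0\<close>,
    \<open>s\<close> is at least \<open>- p\<close>, and \<open>- p + (t + t) = t + r\<close>
    exceeds \<open>\<rho>\<close>.\<close>
  define w where "w m = (\<Sum>k<Suc (Suc m). t)" for m :: nat
  define \<delta> where "\<delta> m = s + (\<Sum>i<n. w m)" for m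
  have "w m < w (Suc m)" for m using t by (simp add: w_def)
  then have "\<delta> m < \<delta> (Suc m)" for m
    unfolding \<delta>_def using n by (intro add_strict_left_mono sum_strict_mono) (auto simp: lessThan_empty_iff)
  then have mono: "strict_mono \<delta>" by (simp add: strict_mono_Suc_iff)
  have lower: "\<rho> < \<delta> m" for m
  proof -
    have "0 \<le> (\<Sum>k<m. t)" using t by (intro sum_nonneg) auto
    then have w: "t + t \<le> w m" by (simp add: w_def add_increasing)
    then have "0 \<le> w m" using t by (meson add_nonneg_nonneg less_imp_le order_trans)
    then have "w m \<le> (\<Sum>i<n. w m)" using sum_mono2[of "{..<n}" "{..<1}" "\<lambda>_. w m"] n by simp
    then have "t + t \<le> (\<Sum>i<n. w m)" using w by (rule order_trans[rotated])
    moreover have "- p \<le> s" using \<open>0 < p\<close> by (auto simp: s_def p_def minus_le_iff)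
    ultimately have le: "- p + (t + t) \<le> \<delta> m" unfolding \<delta>_def by (intro add_mono)
    have "\<rho> < t + r" using t r(2) by (rule add_strict_increasing)
    also have "t + r = - p + (t + t)" by (simp add: t_def algebra_simps)
    also note le
    finally show ?thesis .
  qed
  have "\<delta> m \<in> range (\<lambda>g. \<Sum>i<n. g) \<longleftrightarrow> b" for m
  proof
    assume "\<delta> m \<in> range (\<lambda>g. \<Sum>i<n. g)"
    then obtain g where "s + (\<Sum>i<n. w m) = (\<Sum>i<n. g)" by (auto simp: \<delta>_def)
    then have "s = (\<Sum>i<n. g - w m)" by (simp add: sum_subtractf algebra_simps)
    then have "s \<in> range (\<lambda>g. \<Sum>i<n. g)" by blast
    then show b using g\<^sub>0 by (auto simp: s_def split: if_splits)
  next
    assume b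
    then show "\<delta> m \<in> range (\<lambda>g. \<Sum>i<n. g)" by (simp add: \<delta>_def s_def)
  qed
  with mono lower show ?thesis by blast
qed

section \<open>Ultrametric facts and monochromatic trees\<close>

context valued_field
begin

lemma val_zero [simp]: "v 0 = Infty"
  by (simp add: val_eq_Infty_iff)

lemma val_one: "v 1 = Fin 0"
proof -
  obtain g where g: "v 1 = Fin g" using val_eq_Infty_iff[of 1] by (cases "v 1") auto
  have "v 1 + v 1 = v 1" using val_mult[of 1 1] by simp
  then show ?thesis using g by simp
qed

lemma val_uminus: "v (- x) = v x"
proof -
  obtain g where g: "v (- 1) = Fin g" using val_eq_Infty_iff[of "- 1"] by (cases "v (- 1)") auto
  have "v (- 1) + v (- 1) = Fin 0" using val_mult[of "- 1" "- 1"] val_one by simp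
  then have "g = 0" using g by simp
  then have "v (- x) = Fin 0 + v x" using val_mult[of "- 1" x] g by simp
  then show ?thesis by (cases "v x") auto
qed

lemma val_add_less:
  assumes "v x < v y"
  shows "v (x + y) = v x"
proof (rule antisym)
  have "min (v (x + y)) (v y) \<le> v x" using val_add[of "x + y" "- y"] by (simp add: val_uminus)
  then show "v (x + y) \<le> v x" using assms by (auto simp: min_def split: if_splits)
  show "v x \<le> v (x + y)" using val_add[of x y] assms by (simp add: min_def split: if_splits)
qed

lemma val_power: "v x = Fin g \<Longrightarrow> v (x ^ n) = Fin (\<Sum>i<n. g)"
  by (induction n) (auto simp: val_one val_mult add.commute)

text \<open>First-order form of the condition defining the sets Y: for \<open>n \<ge> 1\<close>,
  values of n-th powers are exactly the elements of n\<Gamma> and, through \<open>z = 0\<close>,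
  infinity.\<close>

definition power_val :: "nat \<Rightarrow> 'k \<Rightarrow> 'k \<Rightarrow> bool" where
  "power_val n a x \<longleftrightarrow> (\<exists>z. v (x - a) = v (z ^ n))"

lemma power_val_refl: "n \<ge> 1 \<Longrightarrow> power_val n a a"
  unfolding power_val_def by (intro exI[of _ 0]) (simp add: power_0_left)

lemma power_val_Fin:
  assumes "v (x - a) = Fin g" "n \<ge> 1"
  shows "power_val n a x \<longleftrightarrow> g \<in> range (\<lambda>g. \<Sum>i<n. g)"
proof
  assume "power_val n a x"
  then obtain z where z: "Fin g = v (z ^ n)" by (auto simp: power_val_def assms)
  then have "v z \<noteq> Infty" using assms(2) by (auto simp: val_eq_Infty_iff power_0_left)
  then obtain h where "v z = Fin h" by (cases "v z") auto
  then have "g = (\<Sum>i<n. h)" using z val_power by simp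
  then show "g \<in> range (\<lambda>g. \<Sum>i<n. g)" by blast
next
  assume "g \<in> range (\<lambda>g. \<Sum>i<n. g)"
  then obtain h where h: "g = (\<Sum>i<n. h)" by blast
  \<comment> \<open>Every element of \<Gamma> is a value, because the valuation is onto.\<close>
  obtain z where "v z = Fin h" using val_surj by (metis surjD)
  then show "power_val n a x" unfolding power_val_def assms(1) h using val_power by metis
qed

text \<open>The statement for every ball provides monochromatic subtrees in infinitely many disjoint
  balls inside a given one. With finitely many colours, infinitely many of them share a colour, and
  three of these become the children of a new root.\<close>

lemma monochromatic_alternating_tree:
  fixes col :: "'k \<Rightarrow> 'c"
  assumes n: "n \<ge> 1" and g\<^sub>0: "g\<^sub>0 \<notin> range (\<lambda>g::'g. \<Sum>i<n. g)" and col: "finite (range col)"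
  shows "\<exists>X q. alternating_tree (power_val n) h X \<and> (\<forall>x\<in>X. Fin \<rho> < v (x - c) \<and> col x = q)"
proof (induction h arbitrary: c \<rho>)
  case 0
  have "alternating_tree (power_val n) 0 {c}" by simp
  then show ?case by (intro exI[of _ "{c}"] exI[of _ "col c"]) simp
next
  case (Suc h)
  \<comment> \<open>The parity of \<open>h\<close> decides whether the distances from
    \<open>c\<close>, and hence between children, lie in n\<Gamma>.\<close>
  obtain \<delta> :: "nat \<Rightarrow> 'g" where \<delta>: "strict_mono \<delta>" "\<And>i. \<rho> < \<delta> i"
    "\<And>i. \<delta> i \<in> range (\<lambda>g. \<Sum>i<n. g) \<longleftrightarrow> odd h"
    using unbounded_coset_sequence[OF n g\<^sub>0, of \<rho> "odd h"] by blast
  have "\<forall>i. \<exists>x. v x = Fin (\<delta> i)" using val_surj by (metis surjD)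
  then obtain d where d: "\<And>i. v (d i) = Fin (\<delta> i)" by metis
  have "\<forall>i. \<exists>X q. alternating_tree (power_val n) h X \<and>
      (\<forall>x\<in>X. Fin (\<delta> i) < v (x - (c + d i)) \<and> col x = q)" using Suc by blast
  then obtain X q where X: "\<And>i. alternating_tree (power_val n) h (X i)"
    and ball: "\<And>i x. x \<in> X i \<Longrightarrow> Fin (\<delta> i) < v (x - (c + d i))"
    and q: "\<And>i x. x \<in> X i \<Longrightarrow> col x = q i" by metis
  have "q i \<in> range col" for i
  proof -
    obtain x where "x \<in> X i" using alternating_tree_nonempty[OF X] by blast
    then show ?thesis using q by (metis rangeI)
  qed
  then have "range q \<subseteq> range col" by blast
  then have "finite (range q)" using col by (rule finite_subset)
  then obtain i\<^sub>0 where "infinite {i. q i = q i\<^sub>0}"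
    using pigeonhole_infinite[of UNIV q] by auto
  then obtain r :: "nat \<Rightarrow> nat" where r: "strict_mono r" "\<And>i. q (r i) = q i\<^sub>0"
    using infinite_enumerate by force
  define Y where "Y = X \<circ> r"
  define \<gamma> where "\<gamma> = \<delta> \<circ> r"
  have \<gamma>: "strict_mono \<gamma>" unfolding \<gamma>_def by (rule strict_mono_o[OF \<delta>(1) r(1)])
  \<comment> \<open>The ball around \<open>c + d (r i)\<close> is smaller than its distance from
    \<open>c\<close>, so all its points have that same distance.\<close>
  have val_c: "v (x - c) = Fin (\<gamma> i)" if "x \<in> Y i" for x i
    using val_add_less[of "d (r i)" "x - (c + d (r i))"] ball[of x "r i"] that d
    by (simp add: Y_def \<gamma>_def)
  \<comment> \<open>Two points at different distances from \<open>c\<close> differ by an element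
    whose value is the smaller of the two.\<close>
  have val_less: "v (x - y) = Fin (\<gamma> i) \<and> v (y - x) = Fin (\<gamma> i)"
    if "x \<in> Y i" "y \<in> Y j" "i < j" for x y i j
  proof -
    have "\<gamma> i < \<gamma> j" using \<gamma> that by (simp add: strict_monoD)
    moreover have vx: "v (x - c) = Fin (\<gamma> i)" by (rule val_c[OF that(1)])
    moreover have vy: "v (- (y - c)) = Fin (\<gamma> j)" unfolding val_uminus by (rule val_c[OF that(2)])
    ultimately have "v (x - c) < v (- (y - c))" by (simp only: Fin_order)
    then have "v ((x - c) + - (y - c)) = Fin (\<gamma> i)" by (simp only: val_add_less vx)
    then show ?thesis using val_uminus[of "x - y"] by simp
  qed
  have rel: "power_val n x y \<longleftrightarrow> odd h" if "x \<in> Y i" "y \<in> Y j" "i \<noteq> j" for x y i j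
  proof -
    have "\<exists>k. v (y - x) = Fin (\<gamma> k)"
      using val_less[OF that(1,2)] val_less[OF that(2,1)] that(3)
      by (cases i j rule: linorder_cases) blast+
    then obtain k where "v (y - x) = Fin (\<gamma> k)" by blast
    then show ?thesis using power_val_Fin[OF _ n] \<delta>(3) by (simp add: \<gamma>_def)
  qed
  have disj: "Y i \<inter> Y j = {}" if "i \<noteq> j" for i j
  proof (rule ccontr)
    assume "Y i \<inter> Y j \<noteq> {}"
    then obtain x where "x \<in> Y i" "x \<in> Y j" by blast
    then have "Fin (\<gamma> i) = Fin (\<gamma> j)" using val_c by metis
    then show False using strict_mono_eq[OF \<gamma>] that by simp
  qed
  have tree: "alternating_tree (power_val n) (Suc h) (\<Union>i<3. Y i)"
    unfolding alternating_tree.simps(2)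
    by (intro exI[of _ Y]) (use X rel disj in \<open>auto simp: Y_def\<close>)
  moreover have "Fin \<rho> < v (x - c) \<and> col x = q i\<^sub>0" if x: "x \<in> (\<Union>i<3. Y i)" for x
  proof -
    obtain i where i: "x \<in> Y i" using x by blast
    then have "col x = q i\<^sub>0" using q r(2) by (metis Y_def comp_apply)
    moreover have "Fin \<rho> < v (x - c)" using val_c[OF i] \<delta>(2) by (simp add: \<gamma>_def)
    ultimately show ?thesis by blast
  qed
  ultimately show ?case by blast
qed

end

section \<open>Definability of the sets and the final contradiction\<close>

primrec power_tm :: "tm \<Rightarrow> nat \<Rightarrow> tm" where
  "power_tm t 0 = t"
| "power_tm t (Suc m) = Mul t (power_tm t m)"

text \<open>Variable 1 is the centre and variable 2 the base of the power. Variable 3 is the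
  difference, given by an equation for lack of subtraction in the language; mutual divisibility
  expresses equal values. The exponent is \<open>Suc m\<close>, since without a constant for 1
  powers start at the term itself.\<close>

definition power_val_fm :: "nat \<Rightarrow> fm" where
  "power_val_fm m = Ex 2 (Ex 3 (Conj (Eq (Add (Var 3) (Var 1)) (Var 0))
     (Conj (Dvd (Var 3) (power_tm (Var 2) m)) (Dvd (power_tm (Var 2) m) (Var 3)))))"

lemma (in valued_field) holds_at_power_val_fm:
  "holds_at field_struct (power_val_fm m) a x \<longleftrightarrow> power_val (Suc m) (a 1) x"
proof -
  have "tm_val field_struct e (power_tm t m) = tm_val field_struct e t ^ Suc m" for e t
    by (induction m) (simp_all add: field_struct_def)
  moreover have "univ field_struct = UNIV" "add_op field_struct = (+)"
    "dvd_rel field_struct = (\<lambda>x y. v x \<le> v y)" by (simp_all add: field_struct_def)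
  ultimately have "holds_at field_struct (power_val_fm m) a x \<longleftrightarrow>
      (\<exists>z w. w + a 1 = x \<and> v w \<le> v (z ^ Suc m) \<and> v (z ^ Suc m) \<le> v w)"
    by (simp add: holds_at_def power_val_fm_def)
  also have "\<dots> \<longleftrightarrow> (\<exists>z w. w = x - a 1 \<and> v w = v (z ^ Suc m))"
    unfolding order_eq_iff[of "v _"] eq_diff_eq ..
  also have "\<dots> \<longleftrightarrow> power_val (Suc m) (a 1) x" by (simp add: power_val_def)
  finally show ?thesis .
qed

text \<open>Each connective at most adds the counts of its arguments. The bound depends only on the
  shape, not on the parameters.\<close>

lemma alternations_comb_fm:
  assumes F: "\<And>\<psi> k. (\<psi>, k) \<in> set_bool_comb \<sigma> \<Longrightarrow>
    alternations (holds_at M \<psi> (e \<circ> slot k)) xs \<le> 2"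
  shows "alternations (holds_at M (comb_fm \<sigma>) e) xs \<le> 2 * size_bool_comb (\<lambda>_. 1) \<sigma>"
    (is "?a \<sigma> \<le> _")
  using F
proof (induction \<sigma>)
  case (Atom p)
  have "holds_at M (comb_fm (Atom p)) e = holds_at M (fst p) (e \<circ> slot (snd p))"
    by (rule ext) (simp add: holds_at_def sat_rename_slot del: fun_upd_apply)
  moreover have "alternations (holds_at M (fst p) (e \<circ> slot (snd p))) xs \<le> 2"
    by (rule Atom) simp
  ultimately have "?a (Atom p) \<le> 2" by (simp only:)
  also have "2 \<le> 2 * size_bool_comb (\<lambda>_. 1) (Atom p)" by simp
  finally show ?case .
next
  case (BNot \<beta>)
  have "?a (BNot \<beta>) \<le> ?a \<beta>"
    by (rule alternations_le_if_implied) (simp add: holds_at_def del: fun_upd_apply)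
  also have "?a \<beta> \<le> 2 * size_bool_comb (\<lambda>_. 1) \<beta>" by (rule BNot.IH, rule BNot.prems) simp
  finally show ?case by simp
next
  case (BAnd \<beta> \<gamma>)
  have "holds_at M (comb_fm (BAnd \<beta> \<gamma>)) e =
      (\<lambda>b. holds_at M (comb_fm \<beta>) e b \<and> holds_at M (comb_fm \<gamma>) e b)"
    by (rule ext) (simp add: holds_at_def del: fun_upd_apply)
  then have "?a (BAnd \<beta> \<gamma>) \<le> ?a \<beta> + ?a \<gamma>"
    using alternations_binop[of "(\<and>)" "holds_at M (comb_fm \<beta>) e" "holds_at M (comb_fm \<gamma>) e" xs]
    by (simp only:)
  moreover have "?a \<beta> \<le> 2 * size_bool_comb (\<lambda>_. 1) \<beta>" by (rule BAnd.IH(1), rule BAnd.prems) simp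
  moreover have "?a \<gamma> \<le> 2 * size_bool_comb (\<lambda>_. 1) \<gamma>" by (rule BAnd.IH(2), rule BAnd.prems) simp
  ultimately show ?case by simp
next
  case (BOr \<beta> \<gamma>)
  have "holds_at M (comb_fm (BOr \<beta> \<gamma>)) e =
      (\<lambda>b. holds_at M (comb_fm \<beta>) e b \<or> holds_at M (comb_fm \<gamma>) e b)"
    by (rule ext) (simp add: holds_at_def del: fun_upd_apply)
  then have "?a (BOr \<beta> \<gamma>) \<le> ?a \<beta> + ?a \<gamma>"
    using alternations_binop[of "(\<or>)" "holds_at M (comb_fm \<beta>) e" "holds_at M (comb_fm \<gamma>) e" xs]
    by (simp only:)
  moreover have "?a \<beta> \<le> 2 * size_bool_comb (\<lambda>_. 1) \<beta>" by (rule BOr.IH(1), rule BOr.prems) simp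
  moreover have "?a \<gamma> \<le> 2 * size_bool_comb (\<lambda>_. 1) \<gamma>" by (rule BOr.IH(2), rule BOr.prems) simp
  ultimately show ?case by simp
qed

theorem theorem4p6:
  fixes v :: "'k::field \<Rightarrow> 'g::linordered_ab_group_add with_infty"
  assumes "valued_field v"
    and "quasi_VC_minimal TYPE('m::infinite) (complete_theory (valued_field.field_struct v))"
  shows "divisible_group TYPE('g)"
proof (rule ccontr)
  assume "\<not> divisible_group TYPE('g)"
  then obtain n :: nat where n: "n \<ge> 1" and "range (\<lambda>g::'g. \<Sum>i<n. g) \<noteq> UNIV"
    unfolding divisible_group_def by blast
  then obtain g\<^sub>0 where g\<^sub>0: "g\<^sub>0 \<notin> range (\<lambda>g::'g. \<Sum>i<n. g)" by blast
  obtain m where m: "n = Suc m" using n by (cases n) auto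
  interpret valued_field v by fact
  define M where "M = field_struct"
  have M: "is_structure M" "univ M = UNIV" by (auto simp: M_def is_structure_def field_struct_def)
  have all: "e \<in> assignments M" for e using M by (simp add: assignments_def)
  obtain \<Psi> where dir: "directed_family {instance_set M \<psi> a | \<psi> a. \<psi> \<in> \<Psi> \<and> a \<in> assignments M}"
    and shapes: "\<And>\<phi>. \<exists>S. finite S \<and>
      (\<forall>\<sigma>\<in>S. \<forall>\<psi>\<in>fst ` set_bool_comb \<sigma>. \<psi> \<in> \<Psi> \<or> free_vars \<psi> \<subseteq> {0}) \<and>
      (\<forall>a\<in>assignments M. \<exists>\<sigma>\<in>S. \<exists>e\<in>assignments M. \<forall>b\<in>univ M.
        holds_at M \<phi> a b \<longleftrightarrow> holds_at M (comb_fm \<sigma>) e b)"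
    using quasi_VC_minimal_uniform[OF M(1) assms(2)[folded M_def]] by blast
  obtain S where S: "finite S" "\<forall>\<sigma>\<in>S. \<forall>\<psi>\<in>fst ` set_bool_comb \<sigma>. \<psi> \<in> \<Psi> \<or> free_vars \<psi> \<subseteq> {0}"
    and S_def: "\<forall>a\<in>assignments M. \<exists>\<sigma>\<in>S. \<exists>e\<in>assignments M. \<forall>b\<in>univ M.
        holds_at M (power_val_fm m) a b \<longleftrightarrow> holds_at M (comb_fm \<sigma>) e b"
    using shapes[of "power_val_fm m"] by blast
  have def: "\<exists>\<sigma>\<in>S. \<exists>e. \<forall>b. holds_at M (power_val_fm m) a b \<longleftrightarrow> holds_at M (comb_fm \<sigma>) e b" for a
    using bspec[OF S_def all[of a]] unfolding M(2) by blast
  define \<Theta> where "\<Theta> = {\<psi> \<in> (\<Union>\<sigma>\<in>S. fst ` set_bool_comb \<sigma>). free_vars \<psi> \<subseteq> {0}}"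
  have "finite \<Theta>" unfolding \<Theta>_def using S(1) finite_set_bool_comb by auto
  \<comment> \<open>The colour of \<open>x\<close> records which of the parameter-free formulas
    occurring in the shapes hold at \<open>x\<close>.\<close>
  define col where "col x = {\<psi> \<in> \<Theta>. sat M (\<lambda>_. x) \<psi>}" for x
  have "range col \<subseteq> Pow \<Theta>" by (auto simp: col_def)
  then have col: "finite (range col)" using \<open>finite \<Theta>\<close> by (meson finite_Pow_iff finite_subset)
  \<comment> \<open>The height exceeds the alternation bound of every shape in \<open>S\<close> at
    once.\<close>
  define h where "h = Suc (\<Sum>\<sigma>\<in>S. 2 * size_bool_comb (\<lambda>_. 1) \<sigma>)"
  obtain X q where X: "alternating_tree (power_val n) h X" "\<And>x. x \<in> X \<Longrightarrow> col x = q"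
    using monochromatic_alternating_tree[OF n g\<^sub>0 col] by metis
  have "\<forall>a. \<exists>\<sigma> e. \<sigma> \<in> S \<and> (\<forall>b. power_val n a b \<longleftrightarrow> holds_at M (comb_fm \<sigma>) e b)"
  proof
    fix a
    obtain \<sigma> e where "\<sigma> \<in> S" "\<And>b. holds_at M (power_val_fm m) (\<lambda>_. a) b \<longleftrightarrow> holds_at M (comb_fm \<sigma>) e b"
      using def[of "\<lambda>_. a"] by blast
    then show "\<exists>\<sigma> e. \<sigma> \<in> S \<and> (\<forall>b. power_val n a b \<longleftrightarrow> holds_at M (comb_fm \<sigma>) e b)"
      using holds_at_power_val_fm[of m "\<lambda>_. a"] unfolding M_def m by blast
  qed
  then obtain \<sigma> e where \<sigma>: "\<And>a. \<sigma> a \<in> S"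
    and e: "\<And>a b. power_val n a b \<longleftrightarrow> holds_at M (comb_fm (\<sigma> a)) (e a) b" by metis
  \<comment> \<open>Instances for all \<open>a\<close> in \<open>X\<close> are collected together:
    the enumeration must be fixed first, as the point with many alternations depends on it.\<close>
  define F where "F = (\<Union>a\<in>X. (\<lambda>p. instance_set M (fst p) (e a \<circ> slot (snd p))) `
    {p \<in> set_bool_comb (\<sigma> a). fst p \<in> \<Psi>})"
  have finX: "finite X" using alternating_tree_finite X(1) by blast
  have F: "finite F" unfolding F_def using finX finite_set_bool_comb by (intro finite_UN_I) auto
  have dirF: "directed_family F"
  proof -
    have "F \<subseteq> {instance_set M \<psi> a | \<psi> a. \<psi> \<in> \<Psi> \<and> a \<in> assignments M}"
    proof
      fix A assume "A \<in> F"
      then obtain a p where "A = instance_set M (fst p) (e a \<circ> slot (snd p))" "fst p \<in> \<Psi>"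
        unfolding F_def by blast
      then show "A \<in> {instance_set M \<psi> a | \<psi> a. \<psi> \<in> \<Psi> \<and> a \<in> assignments M}" using all by blast
    qed
    with dir show ?thesis unfolding directed_family_def by (meson subsetD)
  qed
  obtain xs where xs: "set xs = X" "\<And>A. A \<in> F \<Longrightarrow> alternations (\<lambda>x. x \<in> A) xs \<le> 2"
    using directed_family_convex_enumeration[OF F dirF finX] by blast
  obtain u where "u \<in> X" using alternating_tree_nonempty[OF X(1)] by blast
  then obtain a where a: "a \<in> X" "h \<le> alternations (power_val n a) xs"
    using alternating_tree_alternations[of "power_val n", OF power_val_refl[OF n] X(1) xs(1) \<open>u \<in> X\<close> \<open>u \<in> X\<close>]
    by blast
  have "alternations (holds_at M \<psi> (e a \<circ> slot k)) xs \<le> 2"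
    if p: "(\<psi>, k) \<in> set_bool_comb (\<sigma> a)" for \<psi> k
  proof -
    have "\<psi> \<in> fst ` set_bool_comb (\<sigma> a)" using p by force
    then consider "\<psi> \<in> \<Psi>" | "\<psi> \<in> \<Theta>" "free_vars \<psi> \<subseteq> {0}"
      using S(2) \<sigma>[of a] unfolding \<Theta>_def by blast
    then show ?thesis
    proof cases
      case 1
      then have "(\<psi>, k) \<in> {p \<in> set_bool_comb (\<sigma> a). fst p \<in> \<Psi>}" using p by simp
      then have "instance_set M \<psi> (e a \<circ> slot k) \<in> F"
        unfolding F_def using a(1) by (intro UN_I[of a] image_eqI[of _ _ "(\<psi>, k)"]) simp_all
      moreover have "(\<lambda>x. x \<in> instance_set M \<psi> c) = holds_at M \<psi> c" for c
        by (simp add: instance_set_def M(2))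
      ultimately show ?thesis using xs(2) by metis
    next
      case 2
      \<comment> \<open>A parameter-free formula sees only the colour, which is constant on
        \<open>X\<close>.\<close>
      have "sat M ((e a \<circ> slot k)(0 := b)) \<psi> \<longleftrightarrow> sat M (\<lambda>_. b) \<psi>" for b
        by (rule sat_cong) (use 2(2) in auto)
      then have "holds_at M \<psi> (e a \<circ> slot k) b \<longleftrightarrow> \<psi> \<in> col b" for b
        using 2(1) by (simp only: holds_at_def col_def mem_Collect_eq simp_thms)
      then have "alternations (holds_at M \<psi> (e a \<circ> slot k)) xs = 0"
        using X(2) xs(1) by (intro alternations_constant) simp
      then show ?thesis by simp
    qed
  qed
  then have "alternations (holds_at M (comb_fm (\<sigma> a)) (e a)) xs
      \<le> 2 * size_bool_comb (\<lambda>_. 1) (\<sigma> a)" by (rule alternations_comb_fm)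
  also have "2 * size_bool_comb (\<lambda>_. 1) (\<sigma> a) < h" unfolding h_def less_Suc_eq_le using \<sigma> S(1) by (intro member_le_sum) auto
  finally have "alternations (holds_at M (comb_fm (\<sigma> a)) (e a)) xs < h" .
  moreover have "power_val n a = holds_at M (comb_fm (\<sigma> a)) (e a)" using e by blast
  ultimately show False using a(2) by simp
qed

end
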